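(* Let $S$ be a nonempty closed convex subset of a generalized Banach space $X$. Let $T:S\to S$ be a weakly sequentially continuous operator which is condensing with respect to the measure of weak non-compactness $\mu$. If $T(S)$ is bounded, then $T$ has a fixed point in $S$.
   Context: $\mathbb{R}^n$ is ordered componentwise: $x\le y$ iff $x_i\le y_i$ for all $i$; $x<y$ means $x\le y$ and $x\ne y$. A generalized Banach space (in the sense of Perov) is a real vector space $X$ with a vector-valued norm $\|\cdot\|=(\|\cdot\|_1,\dots,\|\cdot\|_n):X\to\mathbb{R}^n_+$ (i.e. $\|x\|=0$ iff $x=0$, $\|\lambda x\|=|\lambda|\|x\|$, $\|x+y\|\le\|x\|+\|y\|$ componentwise) that is complete for the associated topology (the one given by the scalar norm $\max_i\|x\|_i$). "Closed" and "bounded" refer to this structure. The weak topology of $X$ is the coarsest topology making all continuous linear functionals on $X$ continuous; $x_k\rightharpoonup x$ denotes weak convergence. A map $T:S\to X$ is weakly sequentially continuous if $x_k\rightharpoonup x$ with $x_k,x\in S$ implies $Tx_k\rightharpoonup Tx$. For $r\in\mathbb{R}^n_+$, $B_r=\{x\in X:\|x\|\le r\}$. For a nonempty bounded $V\subseteq X$, $$\mu(V)=\inf\{r\in\mathbb{R}^n_+:\ \text{there is a weakly compact } K\subseteq X \text{ with } V\subseteq K+B_r\},$$ the infimum being taken in $(\mathbb{R}^n,\le)$, i.e. componentwise. $T:S\to X$ is condensing with respect to $\mu$ if $T$ maps bounded sets to bounded sets and $\mu(T(V))<\mu(V)$ for all bounded subsets $V$ of $S$ with $\mu(V)>0_{\mathbb{R}^n}$.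 *)

theory Defs
  imports "HOL-Analysis.Analysis"
begin

text \<open>The order on \<^typ>\<open>real^'n\<close> is the library's componentwise one, and its \<^term>\<open>Inf\<close> is the
  componentwise infimum. The space \<open>X\<close> is the type \<^typ>\<open>'a::real_vector\<close>; its vector-valued norm is
  the parameter \<open>N\<close>.\<close>

definition gen_norm :: "('a::real_vector \<Rightarrow> real^'n) \<Rightarrow> bool" where
  "gen_norm N \<longleftrightarrow>
     (\<forall>x. 0 \<le> N x) \<and>
     (\<forall>x. N x = 0 \<longleftrightarrow> x = 0) \<and>
     (\<forall>c x. N (c *\<^sub>R x) = \<bar>c\<bar> *\<^sub>R N x) \<and>
     (\<forall>x y. N (x + y) \<le> N x + N y)"

definition gen_dist :: "('a::real_vector \<Rightarrow> real^'n) \<Rightarrow> 'a \<Rightarrow> 'a \<Rightarrow> real" where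
  "gen_dist N x y = Max (range (\<lambda>i. N (x - y) $ i))"

definition gen_topology :: "('a::real_vector \<Rightarrow> real^'n) \<Rightarrow> 'a topology" where
  "gen_topology N = Metric_space.mtopology UNIV (gen_dist N)"

definition gen_banach :: "('a::real_vector \<Rightarrow> real^'n) \<Rightarrow> bool" where
  "gen_banach N \<longleftrightarrow> gen_norm N \<and> Metric_space.mcomplete UNIV (gen_dist N)"

definition gen_bounded :: "('a::real_vector \<Rightarrow> real^'n) \<Rightarrow> 'a set \<Rightarrow> bool" where
  "gen_bounded N V \<longleftrightarrow> Metric_space.mbounded UNIV (gen_dist N) V"

definition weak_topology :: "('a::real_vector \<Rightarrow> real^'n) \<Rightarrow> 'a topology" where
  "weak_topology N =
     topology_generated_by
       {f -` U | (f :: 'a \<Rightarrow> real) U.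
          linear f \<and> continuous_map (gen_topology N) euclideanreal f \<and> open U}"

definition weakly_seq_continuous_on ::
    "('a::real_vector \<Rightarrow> real^'n) \<Rightarrow> 'a set \<Rightarrow> ('a \<Rightarrow> 'a) \<Rightarrow> bool" where
  "weakly_seq_continuous_on N S T \<longleftrightarrow>
     (\<forall>u x. range u \<subseteq> S \<longrightarrow> x \<in> S \<longrightarrow> limitin (weak_topology N) u x sequentially
        \<longrightarrow> limitin (weak_topology N) (\<lambda>k. T (u k)) (T x) sequentially)"

definition gen_cball :: "('a::real_vector \<Rightarrow> real^'n) \<Rightarrow> real^'n \<Rightarrow> 'a set" where
  "gen_cball N r = {x. N x \<le> r}"

text \<open>Meant for nonempty bounded \<open>V\<close>. The sum of sets is the Minkowski sum.\<close>

definition weak_noncompactness :: "('a::real_vector \<Rightarrow> real^'n) \<Rightarrow> 'a set \<Rightarrow> real^'n" where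
  "weak_noncompactness N V =
     Inf {r. 0 \<le> r \<and> (\<exists>K. compactin (weak_topology N) K \<and> V \<subseteq> K + gen_cball N r)}"

text \<open>On \<^typ>\<open>real^'n\<close>, \<open>x < y\<close> means \<open>x \<le> y\<close> and \<open>x \<noteq> y\<close>, not strict inequality in every
  component. The empty set need not be excluded below, since its measure is \<open>0\<close>.\<close>

definition weakly_condensing_on ::
    "('a::real_vector \<Rightarrow> real^'n) \<Rightarrow> 'a set \<Rightarrow> ('a \<Rightarrow> 'a) \<Rightarrow> bool" where
  "weakly_condensing_on N S T \<longleftrightarrow>
     (\<forall>V\<subseteq>S. gen_bounded N V \<longrightarrow> gen_bounded N (T ` V)) \<and>
     (\<forall>V\<subseteq>S. gen_bounded N V \<longrightarrow> 0 < weak_noncompactness N V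
        \<longrightarrow> weak_noncompactness N (T ` V) < weak_noncompactness N V)"


lemma gen_dist_le_iff: "gen_dist N x y \<le> b \<longleftrightarrow> (\<forall>i. N (x - y) $ i \<le> b)"
  by (simp add: gen_dist_def)

lemma Metric_space_gen_dist:
  assumes "gen_norm N"
  shows "Metric_space UNIV (gen_dist N)"
proof
  have nn: "0 \<le> N x $ i" for x i
    using assms by (simp add: gen_norm_def less_eq_vec_def)
  have comp: "N (x - y) $ i \<le> gen_dist N x y" for x y i
    by (simp add: gen_dist_def)
  show "0 \<le> gen_dist N x y" for x y
    using order_trans[OF nn comp] .
  have "N (- x) = N x" for x
    using assms[unfolded gen_norm_def]
    by (metis abs_1 abs_minus_cancel scaleR_minus1_left scaleR_one)
  then have "N (x - y) = N (y - x)" for x y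
    by (metis minus_diff_eq)
  then show "gen_dist N x y = gen_dist N y x" for x y
    by (simp add: gen_dist_def)
  show "gen_dist N x y = 0 \<longleftrightarrow> x = y" for x y
  proof
    assume "gen_dist N x y = 0"
    then have "N (x - y) = 0"
      using comp[of x y] nn by (simp add: vec_eq_iff order_antisym)
    then show "x = y" using assms by (simp add: gen_norm_def)
  next
    assume "x = y"
    then have "N (x - y) = 0" using assms by (simp add: gen_norm_def)
    then show "gen_dist N x y = 0" by (simp add: gen_dist_def)
  qed
  show "gen_dist N x z \<le> gen_dist N x y + gen_dist N y z" for x y z
    unfolding gen_dist_le_iff
  proof
    fix i
    have "N ((x - y) + (y - z)) \<le> N (x - y) + N (y - z)"
      using assms unfolding gen_norm_def by blast
    then have "N (x - z) $ i \<le> N (x - y) $ i + N (y - z) $ i"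
      by (simp add: less_eq_vec_def)
    then show "N (x - z) $ i \<le> gen_dist N x y + gen_dist N y z"
      using comp[of x y i] comp[of y z i] by linarith
  qed
qed

lemma gen_bounded_iff:
  assumes "gen_norm N"
  shows "gen_bounded N V \<longleftrightarrow> (\<exists>r. \<forall>x\<in>V. N x \<le> r)"
proof -
  interpret Metric_space UNIV "gen_dist N" by (rule Metric_space_gen_dist[OF assms])
  have comm: "gen_dist N 0 x \<le> b \<longleftrightarrow> (\<forall>i. N x $ i \<le> b)" for x b
    by (subst commute) (simp add: gen_dist_le_iff)
  show ?thesis
  proof
    assume "gen_bounded N V"
    then have "mbounded (insert 0 V)" by (simp add: gen_bounded_def mbounded_insert)
    then obtain b where "\<forall>x\<in>V. gen_dist N 0 x \<le> b"
      by (auto simp: mbounded_alt)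
    then show "\<exists>r. \<forall>x\<in>V. N x \<le> r"
      by (intro exI[of _ "\<chi> i. b"]) (auto simp: less_eq_vec_def comm)
  next
    assume "\<exists>r. \<forall>x\<in>V. N x \<le> r"
    then obtain r where r: "\<forall>x\<in>V. N x \<le> r" by blast
    have "r $ i \<le> Max (range (\<lambda>i. r $ i))" for i by simp
    then have "V \<subseteq> mcball 0 (Max (range (\<lambda>i. r $ i)))"
      using r by (fastforce simp: comm less_eq_vec_def intro: order_trans)
    then show "gen_bounded N V"
      unfolding gen_bounded_def mbounded_def by blast
  qed
qed

lemma topspace_weak_topology [simp]: "topspace (weak_topology N) = UNIV"
proof -
  have "linear (\<lambda>_::'a. 0::real)" by (simp add: linear_iff)
  then have "(\<lambda>_::'a. 0::real) -` UNIV \<in> {f -` U | (f :: 'a \<Rightarrow> real) U.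
          linear f \<and> continuous_map (gen_topology N) euclideanreal f \<and> open U}"
    by (intro CollectI exI[of _ "\<lambda>_. 0"] exI[of _ UNIV]) auto
  then show ?thesis
    unfolding weak_topology_def topology_generated_by_topspace by blast
qed

lemma continuous_map_weak_topology:
  assumes "linear f" "continuous_map (gen_topology N) euclideanreal f"
  shows "continuous_map (weak_topology N) euclideanreal f"
proof -
  have "openin (weak_topology N) (f -` U)" if "open U" for U
    unfolding weak_topology_def using assms that
    by (intro topology_generated_by_Basis) blast
  then show ?thesis
    by (simp add: continuous_map_def vimage_def)
qed

lemma weak_topology_coarsest:
  assumes "topspace X = UNIV"
    and "\<And>f::'a::real_vector \<Rightarrow> real.
           linear f \<Longrightarrow> continuous_map (gen_topology N) euclideanreal f
             \<Longrightarrow> continuous_map X euclideanreal f"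
    and "openin (weak_topology N) U"
  shows "openin X U"
proof -
  have "generate_topology_on {f -` U | (f :: 'a \<Rightarrow> real) U.
          linear f \<and> continuous_map (gen_topology N) euclideanreal f \<and> open U} U"
    using assms(3) unfolding weak_topology_def by (rule openin_topology_generated_by)
  then show ?thesis
  proof induction
    case (Basis s)
    then obtain f :: "'a \<Rightarrow> real" and W where "s = f -` W" "open W"
        "continuous_map X euclideanreal f"
      using assms(2) by blast
    then show ?case
      using assms(1) by (simp add: continuous_map_def vimage_def)
  qed auto
qed

lemma weak_noncompactness_le:
  assumes "0 \<le> r" "compactin (weak_topology N) K" "V \<subseteq> K + gen_cball N r"
  shows "weak_noncompactness N V \<le> r"
proof -
  have "bdd_below ((\<lambda>r. r $ i) ` {r. 0 \<le> r \<and> (\<exists>K. compactin (weak_topology N) K \<and> V \<subseteq> K + gen_cball N r)})" for i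
    by (rule bdd_belowI[of _ 0]) (auto simp: less_eq_vec_def)
  then show ?thesis
    using assms unfolding weak_noncompactness_def
    by (auto simp: less_eq_vec_def Inf_vec_def intro!: cINF_lower)
qed

end

(*
The measure of weak noncompactness is invariant under closed convex hulls, so on the smallest closed
convex invariant set M containing a given point of S, which satisfies M = cl conv ({x0} u T M),
condensation forces the measure of M to vanish. Then M is weakly compact and a Ky Fan best
approximation argument, with limits taken along weakly convergent sequences, gives a fixed point.

S is first replaced by a separable invariant subset, namely the closure of a countable set that is
stable under T and rational convex combinations. In the separable setting every compactness argument
can be run with sequences, and neither the bidual nor the Eberlein-Smulian theorem is needed: a
separable closed convex bounded set is weakly compact as soon as every decreasing sequence of closed
convex subsets of it has a common point, and a common point is found once some point lies close to
all members of such a sequence. For convex hulls of weakly compact sets (Krein-Smulian) this follows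
from Simons' inequality; for sets of measure zero it is done one component of the norm at a time.
*)
theory Submission
  imports Defs "HOL-Complex_Analysis.Great_Picard"
begin

section \<open>Sublinear functionals\<close>

text \<open>\<open>T\<close> is controlled only along weakly convergent sequences, so every limit
  has to be reached by a subsequence rather than by a net. Separability makes this possible through
  a countable family of functionals that separates points. Two features of the vector-valued setting
  matter. The measure is a componentwise infimum, so measure zero yields, for each component
  separately, weakly compact sets that are close in that component alone. And \<open><\<close> says
  only that the measure does not grow and drops in some component; this is enough, since the hull
  argument gives \<open>\<mu>(M) \<le> \<mu>(T(M))\<close> in every component. The best
  approximation step cannot be run with the norm, which is merely lower semicontinuous along weakly
  convergent sequences. Finite sums of absolute values of functionals replace it, and the fixed
  point results from exhausting the separating family.\<close>

definition sublinear :: "('a::real_vector \<Rightarrow> real) \<Rightarrow> bool" where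
  "sublinear p \<longleftrightarrow> (\<forall>x y. p (x + y) \<le> p x + p y) \<and> (\<forall>t x. 0 \<le> t \<longrightarrow> p (t *\<^sub>R x) = t * p x)"

lemma sublinear_add: "sublinear p \<Longrightarrow> p (x + y) \<le> p x + p y"
  and sublinear_scale: "sublinear p \<Longrightarrow> 0 \<le> t \<Longrightarrow> p (t *\<^sub>R x) = t * p x"
  by (auto simp: sublinear_def)

lemma sublinear_zero: "sublinear p \<Longrightarrow> p 0 = 0"
  using sublinear_scale[of p 0 0] by simp

lemma sublinear_neg: "sublinear p \<Longrightarrow> - p (- x) \<le> p x"
  using sublinear_add[of p x "- x"] sublinear_zero[of p] by simp

text \<open>Both the minimality argument and the separation of convex sets lower a sublinear functional
  along a convex set of directions in this way.\<close>

lemma sublinear_lowered: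
  fixes p :: "'a::real_vector \<Rightarrow> real"
  assumes p: "sublinear p" and C: "convex C" "C \<noteq> {}" and a: "\<And>c. c \<in> C \<Longrightarrow> a \<le> p c"
  shows "\<exists>q. sublinear q \<and> (\<forall>x. q x \<le> p x) \<and> (\<forall>c\<in>C. q (- c) \<le> - a)"
proof -
  \<comment> \<open>This makes \<open>q\<close> the largest sublinear functional below
    \<open>p\<close> with \<open>q (- c) \<le> - a\<close> on \<open>C\<close>: any such
    \<open>r\<close> satisfies \<open>r x \<le> r (x + t *\<^sub>R c) + t * r (- c)\<close>.\<close>
  define I where "I x = (\<lambda>(t, c). p (x + t *\<^sub>R c) - t * a) ` ({0..} \<times> C)" for x
  define q where "q x = Inf (I x)" for x
  have ne: "I x \<noteq> {}" for x using C by (auto simp: I_def)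
  have lb: "- p (- x) \<le> p (x + t *\<^sub>R c) - t * a" if "0 \<le> t" "c \<in> C" for x t c
  proof -
    have "t * a \<le> t * p c" using that a by (simp add: mult_left_mono)
    also have "\<dots> = p ((x + t *\<^sub>R c) + - x)" using that sublinear_scale[OF p] by simp
    also have "\<dots> \<le> p (x + t *\<^sub>R c) + p (- x)" by (rule sublinear_add[OF p])
    finally show ?thesis by simp
  qed
  have bdd: "bdd_below (I x)" for x
    by (rule bdd_belowI[of _ "- p (- x)"]) (auto simp: I_def lb)
  have le: "q x \<le> p (x + t *\<^sub>R c) - t * a" if "0 \<le> t" "c \<in> C" for x t c
    unfolding q_def by (rule cInf_lower[OF _ bdd]) (use that in \<open>force simp: I_def\<close>)
  have ge: "m \<le> q x" if "\<And>t c. 0 \<le> t \<Longrightarrow> c \<in> C \<Longrightarrow> m \<le> p (x + t *\<^sub>R c) - t * a" for m x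
    unfolding q_def by (rule cInf_greatest[OF ne]) (use that in \<open>auto simp: I_def\<close>)
  have approx: "\<exists>t c. 0 \<le> t \<and> c \<in> C \<and> p (x + t *\<^sub>R c) - t * a < q x + e" if "0 < e" for x e
  proof (rule ccontr)
    assume "\<not> ?thesis"
    then have "q x + e \<le> q x" by (intro ge) (auto simp: not_less)
    then show False using that by simp
  qed
  have add: "q (x + y) \<le> q x + q y" for x y
  proof (rule field_le_epsilon)
    fix e :: real assume "0 < e"
    then obtain t c s d where h: "0 \<le> t" "c \<in> C" "p (x + t *\<^sub>R c) - t * a < q x + e / 2"
        "0 \<le> s" "d \<in> C" "p (y + s *\<^sub>R d) - s * a < q y + e / 2"
      using approx[of "e / 2" x] approx[of "e / 2" y] by auto
    \<comment> \<open>Convexity of \<open>C\<close> merges two directions into one, which is what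
      subadditivity of \<open>q\<close> needs.\<close>
    obtain b where b: "b \<in> C" "t *\<^sub>R c + s *\<^sub>R d = (t + s) *\<^sub>R b"
    proof (cases "t + s = 0")
      case True
      then have "t = 0" "s = 0" using h by auto
      then show ?thesis using that[of c] h by simp
    next
      case False
      let ?b = "(t / (t + s)) *\<^sub>R c + (s / (t + s)) *\<^sub>R d"
      have "?b \<in> C"
        by (rule convexD[OF C(1)]) (use h False in \<open>auto simp: add_divide_distrib[symmetric]\<close>)
      moreover have "t *\<^sub>R c + s *\<^sub>R d = (t + s) *\<^sub>R ?b"
        using False by (simp add: scaleR_add_right)
      ultimately show ?thesis using that by blast
    qed
    have "q (x + y) \<le> p ((x + y) + (t + s) *\<^sub>R b) - (t + s) * a"
      by (rule le) (use h b in auto)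
    also have "(x + y) + (t + s) *\<^sub>R b = (x + t *\<^sub>R c) + (y + s *\<^sub>R d)"
      using b(2) by (simp add: algebra_simps)
    also have "p \<dots> \<le> p (x + t *\<^sub>R c) + p (y + s *\<^sub>R d)" by (rule sublinear_add[OF p])
    finally show "q (x + y) \<le> q x + q y + e"
      using h by (simp add: algebra_simps)
  qed
  have le_scale: "q (s *\<^sub>R x) \<le> s * q x" if "0 < s" for s x
  proof -
    have "q (s *\<^sub>R x) / s \<le> q x"
    proof (rule ge)
      fix t :: real and c assume tc: "0 \<le> t" "c \<in> C"
      have "q (s *\<^sub>R x) \<le> p (s *\<^sub>R x + (s * t) *\<^sub>R c) - (s * t) * a"
        by (rule le) (use tc that in auto)
      also have "s *\<^sub>R x + (s * t) *\<^sub>R c = s *\<^sub>R (x + t *\<^sub>R c)" by (simp add: scaleR_add_right)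
      also have "p \<dots> = s * p (x + t *\<^sub>R c)" using that by (simp add: sublinear_scale[OF p])
      finally show "q (s *\<^sub>R x) / s \<le> p (x + t *\<^sub>R c) - t * a"
        using that by (simp add: field_simps)
    qed
    then show ?thesis using that by (simp add: field_simps)
  qed
  have qp: "q x \<le> p x" for x
    using C le[of 0 _ x] by auto
  have "q (s *\<^sub>R x) = s * q x" if "0 \<le> s" for s x
  proof (cases "s = 0")
    case True
    have "q 0 \<le> 0" using qp[of 0] sublinear_zero[OF p] by simp
    moreover have "0 \<le> q 0"
      by (rule ge) (use lb[of _ _ 0] sublinear_zero[OF p] in auto)
    ultimately show ?thesis using True by simp
  next
    case False
    then have s: "0 < s" using that by simp
    have "q (inverse s *\<^sub>R (s *\<^sub>R x)) \<le> inverse s * q (s *\<^sub>R x)"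
      by (rule le_scale) (use s in simp)
    then have "s * q x \<le> q (s *\<^sub>R x)" using s by (simp add: field_simps)
    then show ?thesis using le_scale[OF s, of x] by simp
  qed
  then have "sublinear q" using add by (simp add: sublinear_def)
  moreover have "q (- c) \<le> - a" if "c \<in> C" for c
    using le[of 1 c "- c"] that sublinear_zero[OF p] by simp
  ultimately show ?thesis using qp by blast
qed

text \<open>Lowering \<open>q\<close> along the single direction \<open>y\<close> with the value
  \<open>q y\<close> changes nothing by minimality, so \<open>q\<close> is odd, and an odd sublinear
  functional is linear.\<close>

lemma sublinear_minimal_linear:
  assumes q: "sublinear q" and min: "\<And>r. sublinear r \<Longrightarrow> (\<forall>x. r x \<le> q x) \<Longrightarrow> r = q"
  shows "linear q"
proof -
  have neg: "q (- y) = - q y" for y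
  proof -
    obtain r where "sublinear r" "\<forall>x. r x \<le> q x" "r (- y) \<le> - q y"
      using sublinear_lowered[OF q, of "{y}" "q y"] by auto
    then have "q (- y) \<le> - q y" using min by blast
    then show ?thesis using sublinear_neg[OF q, of y] by simp
  qed
  have "q (x + y) = q x + q y" for x y
    using sublinear_add[OF q, of x y] sublinear_add[OF q, of "x + y" "- y"] neg[of y] by simp
  moreover have "q (c *\<^sub>R x) = c * q x" for c x
  proof (cases "0 \<le> c")
    case False
    then have "q ((- c) *\<^sub>R x) = (- c) * q x" by (intro sublinear_scale[OF q]) simp
    then show ?thesis using neg[of "c *\<^sub>R x"] by simp
  qed (simp add: sublinear_scale[OF q])
  ultimately show ?thesis by (intro linearI) auto
qed

text \<open>Hahn-Banach: Zorn's lemma yields a minimal sublinear functional below \<open>p\<close>.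
  The order is reversed, so a chain needs a lower bound, its pointwise infimum.\<close>

lemma sublinear_dominates_linear:
  fixes p :: "'a::real_vector \<Rightarrow> real"
  assumes p: "sublinear p"
  shows "\<exists>f. linear f \<and> (\<forall>x. f x \<le> p x)"
proof -
  define A where "A = {q. sublinear q \<and> q \<le> p}"
  have "\<exists>m\<in>A. \<forall>a\<in>A. a \<le> m \<longrightarrow> a = m"
  proof (rule predicate_Zorn)
    show "partial_order_on A (relation_of (\<lambda>m a. a \<le> m) A)"
      by (rule partial_order_on_relation_ofI) auto
  next
    fix C assume C: "C \<in> Chains (relation_of (\<lambda>m a. a \<le> m) A)"
    then have CA: "C \<subseteq> A" by (auto simp: Chains_def relation_of_def)
    have ch: "a \<le> b \<or> b \<le> a" if "a \<in> C" "b \<in> C" for a b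
      using C that by (auto simp: Chains_def relation_of_def)
    show "\<exists>u\<in>A. \<forall>a\<in>C. u \<le> a"
    proof (cases "C = {}")
      case True
      then show ?thesis using p by (auto simp: A_def)
    next
      case False
      define u where "u x = (INF q\<in>C. q x)" for x
      have bdd: "bdd_below ((\<lambda>q. q x) ` C)" for x
      proof (rule bdd_belowI2[of _ "- p (- x)"])
        fix q assume "q \<in> C"
        then have "sublinear q" "q \<le> p" using CA by (auto simp: A_def)
        then show "- p (- x) \<le> q x"
          using sublinear_neg[of q x] le_funD[of q p "- x"] by linarith
      qed
      have ule: "u x \<le> q x" if "q \<in> C" for q x
        unfolding u_def by (rule cINF_lower[OF bdd that])
      have uge: "m \<le> u x" if "\<And>q. q \<in> C \<Longrightarrow> m \<le> q x" for m x
        unfolding u_def by (rule cINF_greatest[OF False that])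
      have ap: "\<exists>q\<in>C. q x < u x + e" if "0 < e" for x e
      proof (rule ccontr)
        assume "\<not> ?thesis"
        then have "u x + e \<le> u x" by (intro uge) (auto simp: not_less)
        then show False using that by simp
      qed
      have add: "u (x + y) \<le> u x + u y" for x y
      proof (rule field_le_epsilon)
        fix e :: real assume "0 < e"
        then obtain a b where ab: "a \<in> C" "a x < u x + e / 2" "b \<in> C" "b y < u y + e / 2"
          using ap[of "e / 2" x] ap[of "e / 2" y] by auto
        \<comment> \<open>Infima of sublinear functionals need not be subadditive; in a chain one
          member serves both \<open>x\<close> and \<open>y\<close>.\<close>
        obtain c where c: "c \<in> C" "c \<le> a" "c \<le> b" using ch[OF ab(1,3)] ab by auto
        have "u (x + y) \<le> c (x + y)" by (rule ule[OF c(1)])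
        also have "\<dots> \<le> c x + c y" using c CA by (intro sublinear_add) (auto simp: A_def)
        also have "\<dots> \<le> a x + b y" by (rule add_mono[OF le_funD[OF c(2)] le_funD[OF c(3)]])
        finally show "u (x + y) \<le> u x + u y + e" using ab by simp
      qed
      have scale: "u (t *\<^sub>R x) = t * u x" if "0 \<le> t" for t x
      proof -
        have eq: "q (t *\<^sub>R x) = t * q x" if "q \<in> C" for q
          using that CA \<open>0 \<le> t\<close> by (intro sublinear_scale) (auto simp: A_def)
        show ?thesis
        proof (cases "t = 0")
          case True
          have "(\<lambda>q. q 0) ` C = {0 :: real}" using \<open>C \<noteq> {}\<close> eq True by force
          then show ?thesis using True by (simp add: u_def)
        next
          case False
          then have t: "0 < t" using that by simp
          have "t * u x \<le> u (t *\<^sub>R x)"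
            by (rule uge) (simp add: eq mult_left_mono[OF ule] that)
          moreover have "u (t *\<^sub>R x) / t \<le> u x"
          proof (rule uge)
            fix q assume "q \<in> C"
            then have "u (t *\<^sub>R x) \<le> t * q x" using ule[of q "t *\<^sub>R x"] eq by simp
            then show "u (t *\<^sub>R x) / t \<le> q x" using t by (simp add: field_simps)
          qed
          ultimately show ?thesis using t by (simp add: field_simps)
        qed
      qed
      obtain c where c: "c \<in> C" using False by blast
      have "u \<le> p"
      proof (rule le_funI)
        fix x
        have "c x \<le> p x" using c CA by (auto simp: A_def le_fun_def)
        then show "u x \<le> p x" using ule[OF c, of x] by simp
      qed
      then have "u \<in> A" using add scale by (auto simp: A_def sublinear_def)
      then show ?thesis using ule by (auto simp: le_fun_def)
    qed
  qed
  then obtain m where m: "m \<in> A" "\<forall>a\<in>A. a \<le> m \<longrightarrow> a = m" by blast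
  have "linear m"
  proof (rule sublinear_minimal_linear)
    show "sublinear m" using m by (auto simp: A_def)
    fix r assume "sublinear r" "\<forall>x. r x \<le> m x"
    moreover from this have "r \<le> m" by (simp add: le_fun_def)
    ultimately have "r \<in> A" "r \<le> m" using m order_trans[of r m p] by (auto simp: A_def)
    then show "r = m" using m by blast
  qed
  then show ?thesis using m by (auto simp: A_def le_fun_def)
qed

text \<open>After \<open>p\<close> has been lowered along \<open>C\<close>, any linear functional
  \<open>f\<close> below it satisfies \<open>- f c = f (- c) \<le> - a\<close>.\<close>

lemma sublinear_sandwich:
  fixes p :: "'a::real_vector \<Rightarrow> real"
  assumes "sublinear p" "convex C" "\<And>c. c \<in> C \<Longrightarrow> a \<le> p c"
  shows "\<exists>f. linear f \<and> (\<forall>x. f x \<le> p x) \<and> (\<forall>c\<in>C. a \<le> f c)"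
proof (cases "C = {}")
  case True
  then show ?thesis using sublinear_dominates_linear[OF assms(1)] by auto
next
  case False
  then obtain q where q: "sublinear q" "\<forall>x. q x \<le> p x" "\<forall>c\<in>C. q (- c) \<le> - a"
    using sublinear_lowered[OF assms(1,2) False assms(3)] by blast
  obtain f where f: "linear f" "\<forall>x. f x \<le> q x"
    using sublinear_dominates_linear[OF q(1)] by blast
  have "a \<le> f c" if "c \<in> C" for c
    using f(2)[rule_format, of "- c"] q(3) that linear_neg[OF f(1), of c] by fastforce
  moreover have "f x \<le> p x" for x using f(2) q(2) by (meson order_trans)
  ultimately show ?thesis using f(1) by blast
qed

section \<open>Simons' inequality\<close>

text \<open>Each \<open>g n\<close> almost minimises the supremum of \<open>u n + (1/2)^n h\<close> over \<open>h \<in> G n\<close>, where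
  \<open>u n\<close> is the partial sum of the \<open>(1/2)^(j+1) g j\<close>; the full sum \<open>t 0\<close> is a competitor at every
  stage, so at a point where it attains its supremum the tails \<open>t n\<close> cannot drop.\<close>

lemma Simons_inequality:
  fixes G :: "nat \<Rightarrow> ('b \<Rightarrow> real) set" and K :: "'b set"
  assumes ne: "\<And>n. G n \<noteq> {}" and dec: "\<And>n. G (Suc n) \<subseteq> G n"
    and sig: "\<And>n h. (\<And>i. h i \<in> G n) \<Longrightarrow> (\<lambda>x. \<Sum>i. (1/2) ^ Suc i * h i x) \<in> G n"
    and bnd: "\<And>g x. g \<in> G 0 \<Longrightarrow> x \<in> K \<Longrightarrow> \<bar>g x\<bar> \<le> B"
    and att: "\<And>g. g \<in> G 0 \<Longrightarrow> \<exists>b\<in>K. (\<forall>x\<in>K. g x \<le> g b) \<and> m \<le> g b"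
    and e: "0 < e"
  obtains g b where "\<And>n. g n \<in> G n" "b \<in> K" "\<And>n. m - e \<le> (\<Sum>i. (1/2) ^ Suc i * g (n + i) b)"
proof -
  have G0: "G n \<subseteq> G 0" for n
    by (induction n) (use dec in auto)
  have Kne: "K \<noteq> {}" using ne[of 0] att by blast
  define S where "S u = (SUP x\<in>K. u x)" for u :: "'b \<Rightarrow> real"
  \<comment> \<open>At stage \<open>n\<close> the error gets divided by \<open>(1/2) ^ n\<close>,
    which leaves \<open>e * (1/2) ^ (n + 2)\<close>; the total stays below \<open>e\<close>.\<close>
  define \<eta> where "\<eta> n = e * (1/4) ^ Suc n" for n :: nat
  have \<eta>: "0 < \<eta> n" for n using e by (simp add: \<eta>_def)
  define P where "P n u \<longleftrightarrow> (\<exists>c. \<forall>x\<in>K. \<bar>u x\<bar> \<le> c) \<and> (n = 0 \<longrightarrow> u = (\<lambda>_. 0))" for n :: nat and u :: "'b \<Rightarrow> real"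
  \<comment> \<open>The candidates are compared with weight \<open>(1/2) ^ n\<close>, the whole mass
    of the weights still to come, although only half of it is then spent on
    \<open>g\<close>.\<close>
  define Q where "Q n u v \<longleftrightarrow> (\<exists>g\<in>G n. v = (\<lambda>x. u x + (1/2) ^ Suc n * g x) \<and>
      (\<forall>h\<in>G n. S (\<lambda>x. u x + (1/2) ^ n * g x) \<le> S (\<lambda>x. u x + (1/2) ^ n * h x) + \<eta> n))"
    for n :: nat and u v :: "'b \<Rightarrow> real"
  have bnd': "\<exists>c. \<forall>x\<in>K. \<bar>u x + a * g x\<bar> \<le> c" if "\<forall>x\<in>K. \<bar>u x\<bar> \<le> c" "g \<in> G 0" for u g c a
  proof (intro exI ballI)
    fix x assume x: "x \<in> K"
    have "\<bar>u x + a * g x\<bar> \<le> \<bar>u x\<bar> + \<bar>a\<bar> * \<bar>g x\<bar>"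
      by (metis abs_mult abs_triangle_ineq)
    also have "\<dots> \<le> c + \<bar>a\<bar> * B"
      using that bnd[OF that(2) x] x by (intro add_mono mult_left_mono) auto
    finally show "\<bar>u x + a * g x\<bar> \<le> c + \<bar>a\<bar> * B" .
  qed
  have Sup_ge: "u x \<le> S u" if "\<forall>x\<in>K. \<bar>u x\<bar> \<le> c" "x \<in> K" for u c x
    unfolding S_def
    by (rule cSUP_upper[OF that(2)], rule bdd_aboveI2[of _ _ c]) (use that(1) in force)
  have "\<exists>U. \<forall>n. P n (U n) \<and> Q n (U n) (U (Suc n))"
  proof (rule dependent_nat_choice)
    show "\<exists>u. P 0 u" by (auto simp: P_def intro!: exI[of _ "\<lambda>_. 0"])
  next
    fix u n assume "P n u"
    then obtain c where c: "\<forall>x\<in>K. \<bar>u x\<bar> \<le> c" by (auto simp: P_def)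
    define s where "s h = S (\<lambda>x. u x + (1/2) ^ n * h x)" for h
    obtain x where x: "x \<in> K" using Kne by blast
    have low: "- c - B \<le> s h" if "h \<in> G n" for h
    proof -
      have h0: "h \<in> G 0" using that G0 by blast
      obtain d where d: "\<forall>x\<in>K. \<bar>u x + (1/2)^n * h x\<bar> \<le> d" using bnd'[OF c h0] by blast
      have "\<bar>(1/2)^n * h x\<bar> \<le> 1 * B"
        unfolding abs_mult by (intro mult_mono) (use bnd[OF h0 x] in \<open>auto simp: power_le_one\<close>)
      then have "- c - B \<le> u x + (1/2)^n * h x" using c x by fastforce
      also have "\<dots> \<le> s h" unfolding s_def using Sup_ge[OF d x] .
      finally show ?thesis .
    qed
    have "\<exists>g\<in>G n. s g < (INF h\<in>G n. s h) + \<eta> n"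
      using cInf_lessD[of "s ` G n" "(INF h\<in>G n. s h) + \<eta> n"] ne \<eta> by auto
    then obtain g where g: "g \<in> G n" "s g < (INF h\<in>G n. s h) + \<eta> n" by blast
    have "s g \<le> s h + \<eta> n" if "h \<in> G n" for h
      using g(2) cINF_lower[OF bdd_belowI2[of "G n" "- c - B" s, OF low] that] by simp
    then have "Q n u (\<lambda>x. u x + (1/2) ^ Suc n * g x)"
      unfolding Q_def s_def using g(1) by blast
    moreover have "P (Suc n) (\<lambda>x. u x + (1/2) ^ Suc n * g x)"
      unfolding P_def using bnd'[OF c] g(1) G0 by blast
    ultimately show "\<exists>v. P (Suc n) v \<and> Q n u v" by blast
  qed
  then obtain U' where U': "\<And>n. P n (U' n)" "\<And>n. Q n (U' n) (U' (Suc n))" by blast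
  have "\<forall>n. \<exists>g. g \<in> G n \<and> U' (Suc n) = (\<lambda>x. U' n x + (1/2) ^ Suc n * g x) \<and>
      (\<forall>h\<in>G n. S (\<lambda>x. U' n x + (1/2)^n * g x) \<le> S (\<lambda>x. U' n x + (1/2)^n * h x) + \<eta> n)"
    using U'(2) unfolding Q_def by blast
  from choice[OF this] obtain g where g': "\<And>n. g n \<in> G n \<and> U' (Suc n) = (\<lambda>x. U' n x + (1/2) ^ Suc n * g n x) \<and>
      (\<forall>h\<in>G n. S (\<lambda>x. U' n x + (1/2)^n * g n x) \<le> S (\<lambda>x. U' n x + (1/2)^n * h x) + \<eta> n)"
    by blast
  then have g: "\<And>n. g n \<in> G n" "\<And>n. U' (Suc n) = (\<lambda>x. U' n x + (1/2) ^ Suc n * g n x)"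
      "\<And>n h. h \<in> G n \<Longrightarrow> S (\<lambda>x. U' n x + (1/2)^n * g n x) \<le> S (\<lambda>x. U' n x + (1/2)^n * h x) + \<eta> n"
    by blast+
  define t where "t n x = (\<Sum>i. (1/2) ^ Suc i * g (n + i) x)" for n x
  have gn: "g (n + i) \<in> G n" for n i
  proof (induction i arbitrary: n)
    case (Suc i)
    have "g (Suc n + i) \<in> G (Suc n)" by (rule Suc)
    then show ?case using dec[of n] by auto
  qed (simp add: g(1))
  have tG: "t n \<in> G n" for n
    using sig[of "\<lambda>i. g (n + i)" n] gn by (simp add: t_def[abs_def])
  have summ: "summable (\<lambda>i. (1/2) ^ Suc i * g (n + i) x)" if "x \<in> K" for n x
  proof (rule summable_comparison_test)
    show "\<exists>N. \<forall>i\<ge>N. norm ((1/2) ^ Suc i * g (n + i) x) \<le> B * (1/2) ^ Suc i"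
    proof (intro exI allI impI)
      fix i
      have "\<bar>g (n + i) x\<bar> \<le> B" using gn[of n i] G0 bnd that by blast
      then show "norm ((1/2) ^ Suc i * g (n + i) x) \<le> B * (1/2) ^ Suc i"
        by (simp add: abs_mult mult.commute mult_left_mono)
    qed
    show "summable (\<lambda>i. B * (1/2) ^ Suc i)"
      by (intro summable_mult) (simp add: summable_geometric)
  qed
  have trec: "t n x = g n x / 2 + t (Suc n) x / 2" if x: "x \<in> K" for n x
  proof -
    have "t n x = (1/2) ^ Suc 0 * g (n + 0) x + (\<Sum>i. (1/2) ^ Suc (Suc i) * g (n + Suc i) x)"
      unfolding t_def using suminf_split_head[OF summ[OF x, of n]] by simp
    also have "(\<Sum>i. (1/2) ^ Suc (Suc i) * g (n + Suc i) x)
        = (\<Sum>i. (1/2) * ((1/2) ^ Suc i * g (Suc n + i) x))"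
      by (simp add: mult.assoc)
    also have "\<dots> = (1/2) * t (Suc n) x"
      unfolding t_def by (rule suminf_mult[OF summ[OF x]])
    finally show ?thesis by simp
  qed
  have full: "t 0 x = U' n x - U' 0 x + (1/2) ^ n * t n x" if x: "x \<in> K" for n x
  proof (induction n)
    case (Suc n)
    then show ?case using trec[OF x, of n] by (simp add: g(2) algebra_simps)
  qed simp
  have U0: "U' 0 x = 0" for x using U'(1)[of 0] by (simp add: P_def)
  obtain b where b: "b \<in> K" "\<forall>x\<in>K. t 0 x \<le> t 0 b" "m \<le> t 0 b" using att[OF tG] by blast
  have St: "S (\<lambda>x. U' n x + (1/2)^n * t n x) \<le> t 0 b" for n
    unfolding S_def
    by (rule cSUP_least[OF Kne]) (use b full U0 in auto)
  \<comment> \<open>The competitor \<open>t n\<close> completes the partial sum to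
    \<open>t 0\<close>, whose supremum is attained at \<open>b\<close>; the partial sum then cancels
    at \<open>b\<close>.\<close>
  have gt: "g n b \<le> t n b + e * (1/2) ^ Suc (Suc n)" for n
  proof -
    obtain c where c: "\<forall>x\<in>K. \<bar>U' n x\<bar> \<le> c" using U'(1) by (auto simp: P_def)
    obtain d where d: "\<forall>x\<in>K. \<bar>U' n x + (1/2)^n * g n x\<bar> \<le> d"
      using bnd'[OF c] g(1) G0 by blast
    have "U' n b + (1/2)^n * g n b \<le> S (\<lambda>x. U' n x + (1/2)^n * g n x)"
      by (rule Sup_ge[OF d b(1)])
    also have "\<dots> \<le> t 0 b + \<eta> n" using g(3)[OF tG, of n] St[of n] by linarith
    also have "t 0 b = U' n b + (1/2)^n * t n b" using full[OF b(1)] U0 by simp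
    finally have "(1/2)^n * g n b \<le> (1/2)^n * (t n b + e * (1/2) ^ Suc (Suc n))"
      unfolding \<eta>_def by (simp add: algebra_simps power_mult_distrib[symmetric])
    then show ?thesis by (rule mult_left_le_imp_le) simp
  qed
  have "m - e * (1 - (1/2) ^ n) \<le> t n b" for n
  proof (induction n)
    case (Suc n)
    have "t (Suc n) b = 2 * t n b - g n b" using trec[OF b(1), of n] by simp
    then have "t n b - e * (1/2) ^ Suc (Suc n) \<le> t (Suc n) b" using gt[of n] by simp
    moreover have "e * (1/2) ^ Suc (Suc n) \<le> e * (1/2) ^ Suc n"
      using e by (intro mult_left_mono) auto
    ultimately show ?case using Suc by (simp add: algebra_simps)
  qed (use b in simp)
  moreover have "m - e \<le> m - e * (1 - (1/2) ^ n)" for n :: nat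
    using e by (simp add: algebra_simps)
  ultimately have "m - e \<le> t n b" for n by (meson order_trans)
  then show ?thesis using that[of g b] g(1) b(1) by (simp add: t_def)
qed

section \<open>Complete norms given as functions\<close>

text \<open>The norm is a function rather than a type class operation because the vector-valued norm
  is itself a parameter; the locale is later interpreted with the maximum of its components.\<close>

locale complete_norm =
  fixes nrm :: "'a::real_vector \<Rightarrow> real"
  assumes nrm_add: "nrm (x + y) \<le> nrm x + nrm y"
    and nrm_scale: "nrm (c *\<^sub>R x) = \<bar>c\<bar> * nrm x"
    and nrm_eq_0D: "nrm x = 0 \<Longrightarrow> x = 0"
    and nrm_complete: "(\<And>e. 0 < e \<Longrightarrow> \<exists>k. \<forall>m\<ge>k. \<forall>n\<ge>k. nrm (u m - u n) < e)
      \<Longrightarrow> \<exists>x. (\<lambda>n. nrm (u n - x)) \<longlonglongrightarrow> 0"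
begin

definition cl :: "'a set \<Rightarrow> 'a set" where
  "cl A = {x. \<forall>e>0. \<exists>a\<in>A. nrm (a - x) < e}"

definition clos :: "'a set \<Rightarrow> bool" where
  "clos A \<longleftrightarrow> cl A \<subseteq> A"

text \<open>The closed unit ball of the dual space: the one-sided bound is two-sided because
  \<open>f\<close> is odd. Every continuous functional is a multiple of such an \<open>f\<close>, so
  these suffice to test weak convergence.\<close>

definition dual :: "('a \<Rightarrow> real) \<Rightarrow> bool" where
  "dual f \<longleftrightarrow> linear f \<and> (\<forall>x. f x \<le> nrm x)"

definition wlim :: "(nat \<Rightarrow> 'a) \<Rightarrow> 'a \<Rightarrow> bool" where
  "wlim u x \<longleftrightarrow> (\<forall>f. dual f \<longrightarrow> (\<lambda>n. f (u n)) \<longlonglongrightarrow> f x)"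

text \<open>\<open>Z\<close> may lie outside \<open>A\<close>, which makes separability pass to
  subsets at once.\<close>

definition sep :: "'a set \<Rightarrow> bool" where
  "sep A \<longleftrightarrow> (\<exists>Z. countable Z \<and> A \<subseteq> cl Z)"

definition nested :: "(nat \<Rightarrow> 'a set) \<Rightarrow> bool" where
  "nested H \<longleftrightarrow> (\<forall>n. convex (H n) \<and> clos (H n) \<and> H (Suc n) \<subseteq> H n)"

text \<open>What weak compactness gives for decreasing sequences of closed convex sets. By Smulian's
  theorem (\<open>wfip_imp_wseq\<close>) nothing is lost for bounded separable sets.\<close>

definition wfip :: "'a set \<Rightarrow> bool" where
  "wfip K \<longleftrightarrow> (\<forall>H. nested H \<longrightarrow> (\<forall>n. K \<inter> H n \<noteq> {}) \<longrightarrow> (\<exists>x\<in>K. \<forall>n. x \<in> H n))"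

definition wseq :: "'a set \<Rightarrow> bool" where
  "wseq M \<longleftrightarrow> (\<forall>u. (\<forall>n. u n \<in> M) \<longrightarrow> (\<exists>x\<in>M. \<exists>r. strict_mono (r :: nat \<Rightarrow> nat) \<and> wlim (u \<circ> r) x))"

lemma nrm_0 [simp]: "nrm 0 = 0"
  using nrm_scale[of 0 0] by simp

lemma nrm_minus [simp]: "nrm (- x) = nrm x"
  using nrm_scale[of "- 1" x] by simp

lemma nrm_ge_0 [simp]: "0 \<le> nrm x"
  using nrm_add[of x "- x"] by simp

lemma nrm_commute: "nrm (x - y) = nrm (y - x)"
  using nrm_minus[of "x - y"] by simp

lemma nrm_triangle: "nrm (x - z) \<le> nrm (x - y) + nrm (y - z)"
  using nrm_add[of "x - y" "y - z"] by simp

lemma nrm_pos: "x \<noteq> y \<Longrightarrow> 0 < nrm (x - y)"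
  using nrm_eq_0D[of "x - y"] nrm_ge_0[of "x - y"] by (auto simp: less_le)

lemma sublinear_nrm: "sublinear nrm"
  by (simp add: sublinear_def nrm_add nrm_scale)

subsection \<open>Closure\<close>

lemma subset_cl: "A \<subseteq> cl A"
  by (force simp: cl_def)

lemma cl_mono: "A \<subseteq> B \<Longrightarrow> cl A \<subseteq> cl B"
  by (fastforce simp: cl_def)

lemma closD: "clos A \<Longrightarrow> (\<And>e. 0 < e \<Longrightarrow> \<exists>a\<in>A. nrm (a - x) < e) \<Longrightarrow> x \<in> A"
  by (auto simp: clos_def cl_def)

lemma clos_cl: "clos (cl A)"
  unfolding clos_def
proof
  fix x assume x: "x \<in> cl (cl A)"
  have "\<exists>a\<in>A. nrm (a - x) < e" if e: "0 < e" for e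
  proof -
    obtain b where b: "b \<in> cl A" "nrm (b - x) < e / 2"
      using x half_gt_zero[OF e] unfolding cl_def[of "cl A"] by blast
    then obtain a where "a \<in> A" "nrm (a - b) < e / 2"
      using half_gt_zero[OF e] unfolding cl_def by blast
    then show ?thesis using b nrm_triangle[of a x b] by (intro bexI[of _ a]) auto
  qed
  then show "x \<in> cl A" by (auto simp: cl_def)
qed

lemma cl_minimal: "A \<subseteq> B \<Longrightarrow> clos B \<Longrightarrow> cl A \<subseteq> B"
  using cl_mono[of A B] by (auto simp: clos_def)

lemma clos_Int: "clos A \<Longrightarrow> clos B \<Longrightarrow> clos (A \<inter> B)"
  using cl_mono[of "A \<inter> B" A] cl_mono[of "A \<inter> B" B] by (auto simp: clos_def)

lemma clos_Inter: "(\<And>A. A \<in> F \<Longrightarrow> clos A) \<Longrightarrow> clos (\<Inter>F)"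
  unfolding clos_def by (meson Inter_greatest Inter_lower cl_mono order_trans)

lemma clos_limit:
  assumes "clos A" "\<forall>n. u n \<in> A" "(\<lambda>n. nrm (u n - x)) \<longlonglongrightarrow> 0"
  shows "x \<in> A"
proof (rule closD[OF assms(1)])
  fix e :: real assume "0 < e"
  then obtain n where "nrm (u n - x) < e"
    using order_tendstoD(2)[OF assms(3)] by (auto simp: eventually_sequentially)
  then show "\<exists>a\<in>A. nrm (a - x) < e" using assms(2) by blast
qed

lemma cl_seq:
  assumes "x \<in> cl A"
  obtains u where "\<And>n::nat. u n \<in> A" "(\<lambda>n. nrm (u n - x)) \<longlonglongrightarrow> 0"
proof -
  have "\<forall>n::nat. \<exists>a. a \<in> A \<and> nrm (a - x) < inverse (real (Suc n))"
  proof
    fix n :: nat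
    have "0 < inverse (real (Suc n))" by simp
    then show "\<exists>a. a \<in> A \<and> nrm (a - x) < inverse (real (Suc n))"
      using assms unfolding cl_def by blast
  qed
  from choice[OF this] obtain u where
    u: "\<And>n. u n \<in> A" "\<And>n::nat. nrm (u n - x) < inverse (real (Suc n))" by blast
  have "(\<lambda>n. nrm (u n - x)) \<longlonglongrightarrow> 0"
    by (rule tendsto_sandwich[OF _ _ tendsto_const LIMSEQ_inverse_real_of_nat])
      (use u(2) in \<open>auto intro!: always_eventually less_imp_le\<close>)
  then show ?thesis using that u(1) by blast
qed

lemma convex_cl:
  assumes "convex A"
  shows "convex (cl A)"
proof (rule convexI)
  fix x y and s t :: real
  assume xy: "x \<in> cl A" "y \<in> cl A" and st: "0 \<le> s" "0 \<le> t" "s + t = 1"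
  have "\<exists>a\<in>A. nrm (a - (s *\<^sub>R x + t *\<^sub>R y)) < e" if e: "0 < e" for e
  proof -
    obtain a b where ab: "a \<in> A" "nrm (a - x) < e" "b \<in> A" "nrm (b - y) < e"
      using xy e unfolding cl_def by blast
    have "(s *\<^sub>R a + t *\<^sub>R b) - (s *\<^sub>R x + t *\<^sub>R y) = s *\<^sub>R (a - x) + t *\<^sub>R (b - y)"
      by (simp add: algebra_simps)
    also have "nrm \<dots> \<le> s * nrm (a - x) + t * nrm (b - y)"
      using nrm_add[of "s *\<^sub>R (a - x)" "t *\<^sub>R (b - y)"] st by (simp add: nrm_scale)
    also have "\<dots> < e"
      by (rule convex_bound_lt) (use ab st in auto)
    finally show ?thesis using convexD[OF assms ab(1,3) st] by blast
  qed
  then show "s *\<^sub>R x + t *\<^sub>R y \<in> cl A" by (auto simp: cl_def)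
qed

text \<open>A general \<open>q\<close> below the norm is allowed so that the result also covers
  single components of the vector-valued norm.\<close>

lemma clos_seminorm_le:
  assumes "\<And>x y. q (x + y) \<le> q x + q y" "\<And>x. q x \<le> nrm x"
  shows "clos {x. q (x - a) \<le> r}"
  unfolding clos_def
proof
  fix x assume x: "x \<in> cl {x. q (x - a) \<le> r}"
  have "q (x - a) \<le> r"
  proof (rule field_le_epsilon)
    fix e :: real assume "0 < e"
    then obtain b where b: "q (b - a) \<le> r" "nrm (b - x) < e"
      using x by (auto simp: cl_def)
    have "q (x - a) \<le> q (x - b) + q (b - a)" using assms(1)[of "x - b" "b - a"] by simp
    also have "q (x - b) \<le> e" using assms(2)[of "x - b"] b(2) by (simp add: nrm_commute)
    finally show "q (x - a) \<le> r + e" using b(1) by simp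
  qed
  then show "x \<in> {x. q (x - a) \<le> r}" by simp
qed

lemma convex_seminorm_le:
  fixes q :: "'a \<Rightarrow> real"
  assumes "\<And>x y. q (x + y) \<le> q x + q y" "\<And>c x. q (c *\<^sub>R x) = \<bar>c\<bar> * q x"
  shows "convex {x. q (x - a) \<le> r}"
proof (rule convexI)
  fix x y and s t :: real
  assume xy: "x \<in> {x. q (x - a) \<le> r}" "y \<in> {x. q (x - a) \<le> r}" and st: "0 \<le> s" "0 \<le> t" "s + t = 1"
  have "s *\<^sub>R x + t *\<^sub>R y - a = s *\<^sub>R (x - a) + t *\<^sub>R (y - a) + (s + t - 1) *\<^sub>R a"
    by (simp add: algebra_simps)
  also have "(s + t - 1) *\<^sub>R a = 0" using st(3) by simp
  also have "q (s *\<^sub>R (x - a) + t *\<^sub>R (y - a) + 0) \<le> s * q (x - a) + t * q (y - a)"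
    using assms(1)[of "s *\<^sub>R (x - a)" "t *\<^sub>R (y - a)"] st by (simp add: assms(2))
  also have "\<dots> \<le> r" by (rule convex_bound_le) (use xy st in auto)
  finally show "s *\<^sub>R x + t *\<^sub>R y \<in> {x. q (x - a) \<le> r}" by simp
qed

subsection \<open>Functionals and separation\<close>

lemma dual_abs: "dual f \<Longrightarrow> \<bar>f x\<bar> \<le> nrm x"
  using linear_neg[of f x] nrm_minus[of x] unfolding dual_def
  by (metis abs_le_iff)

lemma dual_linear: "dual f \<Longrightarrow> linear f"
  by (simp add: dual_def)

lemma dual_diff: "dual f \<Longrightarrow> f (x - y) = f x - f y"
  by (simp add: dual_def linear_diff)

lemma dual_add: "dual f \<Longrightarrow> f (x + y) = f x + f y"
  by (simp add: dual_def linear_add)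

lemma dual_scale: "dual f \<Longrightarrow> f (c *\<^sub>R x) = c * f x"
  by (simp add: dual_def linear_cmul)

lemma dual_uminus: "dual f \<Longrightarrow> dual (\<lambda>x. - f x)"
  using dual_abs[of f] by (auto simp: dual_def intro: linear_compose_neg) (meson abs_le_D2)

lemma clos_dual_ge:
  assumes "dual f" shows "clos {x. a \<le> f x}"
  unfolding clos_def
proof
  fix x assume x: "x \<in> cl {x. a \<le> f x}"
  have "a \<le> f x"
  proof (rule field_le_epsilon)
    fix e :: real assume "0 < e"
    then obtain b where b: "a \<le> f b" "nrm (b - x) < e" using x by (auto simp: cl_def)
    then show "a \<le> f x + e" using dual_abs[OF assms, of "b - x"] by (simp add: dual_diff[OF assms])
  qed
  then show "x \<in> {x. a \<le> f x}" by simp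
qed

lemma convex_dual_ge:
  assumes "dual f" shows "convex {x. a \<le> f x}"
proof -
  have "{x. a \<le> f x} = f -` {a..}" by auto
  then show ?thesis using convex_linear_vimage[OF dual_linear[OF assms], of "{a..}"] by simp
qed

text \<open>Hahn-Banach in quantitative form: a functional from the dual unit ball keeps the full
  distance \<open>d\<close> of \<open>C\<close> from the origin.\<close>

lemma separation:
  assumes "convex C" "\<And>c. c \<in> C \<Longrightarrow> d \<le> nrm c"
  obtains f where "dual f" "\<And>c. c \<in> C \<Longrightarrow> d \<le> f c"
  using sublinear_sandwich[OF sublinear_nrm assms] unfolding dual_def by blast

lemma norming:
  obtains f where "dual f" "f x = nrm x"
proof -
  obtain f where "dual f" "nrm x \<le> f x" using separation[of "{x}" "nrm x"] by auto
  then show ?thesis using that unfolding dual_def by (metis order_antisym)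
qed

lemma Mazur_separation:
  assumes "convex H" "clos H" "x \<notin> H"
  obtains f e where "dual f" "0 < e" "\<And>h. h \<in> H \<Longrightarrow> f x + e \<le> f h"
proof -
  obtain e where e: "0 < e" "\<And>h. h \<in> H \<Longrightarrow> e \<le> nrm (h - x)"
    using closD[OF assms(2), of x] assms(3) by (metis not_less)
  have "convex ((\<lambda>h. h - x) ` H)" using assms(1) by simp
  moreover have "e \<le> nrm c" if "c \<in> (\<lambda>h. h - x) ` H" for c using that e by auto
  ultimately obtain f where f: "dual f" "\<And>c. c \<in> (\<lambda>h. h - x) ` H \<Longrightarrow> e \<le> f c"
    using separation[of "(\<lambda>h. h - x) ` H" e] by blast
  have "f x + e \<le> f h" if "h \<in> H" for h
    using f(2)[of "h - x"] that by (simp add: dual_diff[OF f(1)])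
  then show ?thesis using that f(1) e(1) by blast
qed

lemma wlim_clos_convex:
  assumes "wlim u x" "\<And>n. u n \<in> H" "convex H" "clos H"
  shows "x \<in> H"
proof (rule ccontr)
  assume "x \<notin> H"
  then obtain f e where f: "dual f" "0 < e" "\<And>h. h \<in> H \<Longrightarrow> f x + e \<le> f h"
    using Mazur_separation[OF assms(3,4)] by blast
  have "(\<lambda>n. f (u n)) \<longlonglongrightarrow> f x" using assms(1) f(1) by (simp add: wlim_def)
  then have "f x + e \<le> f x" by (rule LIMSEQ_le_const) (use f(3) assms(2) in auto)
  then show False using f(2) by simp
qed

lemma wlim_of_lim:
  assumes "(\<lambda>n. nrm (u n - x)) \<longlonglongrightarrow> 0"
  shows "wlim u x"
  unfolding wlim_def
proof (intro allI impI)
  fix f assume f: "dual f"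
  have "(\<lambda>n. f (u n) - f x) \<longlonglongrightarrow> 0"
    by (rule Lim_null_comparison[OF _ assms])
      (use dual_abs[OF f] in \<open>auto simp: dual_diff[OF f, symmetric]\<close>)
  then show "(\<lambda>n. f (u n)) \<longlonglongrightarrow> f x" by (simp add: LIM_zero_iff)
qed

lemma wlim_subseq: "wlim u x \<Longrightarrow> strict_mono r \<Longrightarrow> wlim (u \<circ> r) x"
  using LIMSEQ_subseq_LIMSEQ[of "\<lambda>n. f (u n)" "f x" r for f] unfolding wlim_def o_def by blast

lemma wlim_diff: "wlim u x \<Longrightarrow> wlim v y \<Longrightarrow> wlim (\<lambda>n. u n - v n) (x - y)"
  unfolding wlim_def by (auto simp: dual_diff intro!: tendsto_diff)

section \<open>Separability and countable dense subsets\<close>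

lemma sep_subset: "sep B \<Longrightarrow> A \<subseteq> B \<Longrightarrow> sep A"
  by (auto simp: sep_def)

text \<open>Each ball of radius \<open>1/(n+1)\<close> around a point of \<open>Y\<close> that meets
  \<open>A\<close> contributes one point of \<open>A\<close>.\<close>

lemma sep_dense:
  assumes "sep A"
  obtains Z where "countable Z" "Z \<subseteq> A" "A \<subseteq> cl Z"
proof -
  obtain Y where Y: "countable Y" "A \<subseteq> cl Y" using assms by (auto simp: sep_def)
  define P where "P = (\<lambda>(y, n::nat) a. a \<in> A \<and> nrm (y - a) < inverse (real (Suc n)))"
  define Z where "Z = (\<lambda>p. SOME a. P p a) ` {p \<in> Y \<times> UNIV. \<exists>a. P p a}"
  have "countable Z"
    unfolding Z_def by (intro countable_image countable_subset[OF Collect_subset] countable_SIGMA Y) auto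
  moreover have "Z \<subseteq> A"
  proof
    fix z assume "z \<in> Z"
    then obtain p where "z = (SOME a. P p a)" "\<exists>a. P p a" by (auto simp: Z_def)
    then have "P p z" by (simp add: someI_ex)
    then show "z \<in> A" by (cases p) (simp add: P_def)
  qed
  moreover have "a \<in> cl Z" if a: "a \<in> A" for a
    unfolding cl_def
  proof (intro CollectI allI impI)
    fix e :: real assume "0 < e"
    then obtain n where n: "inverse (real (Suc n)) < e / 2" using reals_Archimedean[of "e / 2"] by auto
    have "0 < inverse (real (Suc n))" by simp
    then obtain y where y: "y \<in> Y" "nrm (y - a) < inverse (real (Suc n))"
      using a Y(2) unfolding cl_def by blast
    then have ex: "\<exists>a. P (y, n) a" using a by (auto simp: P_def)
    define z where "z = (SOME a. P (y, n) a)"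
    have "P (y, n) z" unfolding z_def by (rule someI_ex[OF ex])
    then have "nrm (y - z) < inverse (real (Suc n))" by (simp add: P_def)
    then have "nrm (z - a) < e" using n y nrm_triangle[of z a y] nrm_commute[of z y] by linarith
    moreover have "z \<in> Z" unfolding Z_def z_def using ex y by (intro image_eqI[of _ _ "(y, n)"]) auto
    ultimately show "\<exists>z\<in>Z. nrm (z - a) < e" by blast
  qed
  ultimately show ?thesis using that by blast
qed

text \<open>Allowing an operator \<open>T\<close> here, the same closure yields invariant separable convex sets.\<close>

lemma countable_convex_closure:
  fixes T :: "'a \<Rightarrow> 'a"
  assumes "countable A"
  obtains Z where "countable Z" "A \<subseteq> Z" "T ` Z \<subseteq> Z" "convex (cl Z)"
    and "\<And>C. A \<subseteq> C \<Longrightarrow> convex C \<Longrightarrow> T ` C \<subseteq> C \<Longrightarrow> Z \<subseteq> C"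
proof -
  define Q where "Q = {q. q \<in> \<rat> \<and> (0::real) \<le> q \<and> q \<le> 1}"
  define step where
    "step B = B \<union> T ` B \<union> (\<lambda>(q, x, y). q *\<^sub>R x + (1 - q) *\<^sub>R y) ` (Q \<times> B \<times> B)" for B
  define F where "F n = (step ^^ n) A" for n
  define Z where "Z = (\<Union>n. F n)"
  have FS: "F (Suc n) = step (F n)" for n by (simp add: F_def)
  have Q: "countable Q" using countable_rat unfolding Q_def by (rule countable_subset[rotated]) auto
  have F0: "F 0 = A" by (simp add: F_def)
  have "countable (step B)" if "countable B" for B
    unfolding step_def by (intro countable_Un countable_image countable_SIGMA Q that)
  then have "countable (F n)" for n
    by (induction n) (simp_all add: F0 FS assms)
  then have cZ: "countable Z" by (auto simp: Z_def)
  have mono: "F m \<subseteq> F n" if "m \<le> n" for m n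
    by (rule lift_Suc_mono_le[OF _ that]) (auto simp: FS step_def)
  have AZ: "A \<subseteq> Z" using F0 by (auto simp: Z_def)
  have TZ: "T ` Z \<subseteq> Z"
  proof
    fix y assume "y \<in> T ` Z"
    then obtain n where "y \<in> T ` F n" by (auto simp: Z_def)
    then have "y \<in> F (Suc n)" by (auto simp: FS step_def)
    then show "y \<in> Z" by (auto simp: Z_def)
  qed
  have comb: "q *\<^sub>R x + (1 - q) *\<^sub>R y \<in> Z" if q: "q \<in> Q" and xy: "x \<in> Z" "y \<in> Z" for q x y
  proof -
    obtain m n where "x \<in> F m" "y \<in> F n" using xy by (auto simp: Z_def)
    then have "x \<in> F (max m n)" "y \<in> F (max m n)" using mono[of m "max m n"] mono[of n "max m n"] by auto
    then have "q *\<^sub>R x + (1 - q) *\<^sub>R y \<in> F (Suc (max m n))"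
      unfolding FS step_def using q by (auto intro!: image_eqI[of _ _ "(q, x, y)"])
    then show ?thesis by (auto simp: Z_def)
  qed
  have "convex (cl Z)"
  proof (rule convexI)
    fix x y and s t :: real
    assume xy: "x \<in> cl Z" "y \<in> cl Z" and st: "0 \<le> s" "0 \<le> t" "s + t = 1"
    have "\<exists>a\<in>cl Z. nrm (a - (s *\<^sub>R x + t *\<^sub>R y)) < e" if e: "0 < e" for e
    proof -
      obtain a b where ab: "a \<in> Z" "nrm (a - x) < e / 2" "b \<in> Z" "nrm (b - y) < e / 2"
        using xy half_gt_zero[OF e] unfolding cl_def by blast
      \<comment> \<open>Replacing the coefficient \<open>s\<close> by \<open>q\<close> moves the
        combination by \<open>\<bar>q - s\<bar> * nrm (a - b)\<close>, hence by at most
        \<open>e / 2\<close>.\<close>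
      define d where "d = e / 2 / (1 + nrm (a - b))"
      have pos: "0 < 1 + nrm (a - b)" by (simp add: add_pos_nonneg)
      have d: "0 < d" using e pos by (simp add: d_def)
      have "\<exists>q\<in>Q. \<bar>q - s\<bar> < d"
      proof (cases "s = 0")
        case True
        then show ?thesis using d by (intro bexI[of _ 0]) (auto simp: Q_def)
      next
        case False
        \<comment> \<open>Approximating \<open>s\<close> from below keeps \<open>q\<close> in the
          unit interval.\<close>
        then obtain q where "q \<in> \<rat>" "max 0 (s - d) < q" "q < s"
          using Rats_dense_in_real[of "max 0 (s - d)" s] st d by auto
        then show ?thesis using st by (intro bexI[of _ q]) (auto simp: Q_def)
      qed
      then obtain q where q: "q \<in> Q" "\<bar>q - s\<bar> < d" by blast
      have t: "t = 1 - s" using st by simp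
      have "(q *\<^sub>R a + (1 - q) *\<^sub>R b) - (s *\<^sub>R x + t *\<^sub>R y)
          = (q - s) *\<^sub>R (a - b) + (s *\<^sub>R (a - x) + t *\<^sub>R (b - y))"
        unfolding t by (simp add: algebra_simps)
      also have "nrm \<dots> \<le> nrm ((q - s) *\<^sub>R (a - b)) + (nrm (s *\<^sub>R (a - x)) + nrm (t *\<^sub>R (b - y)))"
        using nrm_add[of "(q - s) *\<^sub>R (a - b)" "s *\<^sub>R (a - x) + t *\<^sub>R (b - y)"]
          nrm_add[of "s *\<^sub>R (a - x)" "t *\<^sub>R (b - y)"] by linarith
      also have "\<dots> = \<bar>q - s\<bar> * nrm (a - b) + (s * nrm (a - x) + t * nrm (b - y))"
        using st by (simp add: nrm_scale)
      also have "\<dots> < e / 2 + e / 2"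
      proof (rule add_le_less_mono)
        have "\<bar>q - s\<bar> * nrm (a - b) \<le> d * (1 + nrm (a - b))"
          using q(2) by (intro mult_mono) auto
        also have "\<dots> = e / 2" by (rule iffD1[OF nonzero_eq_divide_eq[OF less_imp_neq[OF pos, THEN not_sym]] d_def])
        finally show "\<bar>q - s\<bar> * nrm (a - b) \<le> e / 2" .
        show "s * nrm (a - x) + t * nrm (b - y) < e / 2"
          by (rule convex_bound_lt) (use ab st in auto)
      qed
      finally have "nrm (q *\<^sub>R a + (1 - q) *\<^sub>R b - (s *\<^sub>R x + t *\<^sub>R y)) < e" by simp
      moreover have "q *\<^sub>R a + (1 - q) *\<^sub>R b \<in> cl Z"
        using comb[OF q(1) ab(1,3)] subset_cl[of Z] by blast
      ultimately show ?thesis by blast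
    qed
    then show "s *\<^sub>R x + t *\<^sub>R y \<in> cl Z" by (rule closD[OF clos_cl])
  qed
  moreover have "Z \<subseteq> C" if C: "A \<subseteq> C" "convex C" "T ` C \<subseteq> C" for C
  proof -
    have "F n \<subseteq> C" for n
    proof (induction n)
      case (Suc n)
      have comb': "q *\<^sub>R x + (1 - q) *\<^sub>R y \<in> C" if "q \<in> Q" "x \<in> F n" "y \<in> F n" for q x y
        by (rule convexD[OF C(2)]) (use that Suc in \<open>auto simp: Q_def\<close>)
      have "T ` F n \<subseteq> C" using Suc C(3) by blast
      then show ?case using Suc by (auto simp: FS step_def intro: comb')
    qed (use C F0 in simp)
    then show ?thesis by (auto simp: Z_def)
  qed
  ultimately show ?thesis using that cZ AZ TZ by blast
qed

lemma sep_cl_convex_hull: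
  assumes "sep A"
  shows "sep (cl (convex hull A))"
proof -
  obtain Y where Y: "countable Y" "A \<subseteq> cl Y" using assms by (auto simp: sep_def)
  obtain Z where Z: "countable Z" "Y \<subseteq> Z" "convex (cl Z)"
    by (rule countable_convex_closure[OF Y(1), of id]) blast
  have "A \<subseteq> cl Z" using Y(2) cl_mono[OF Z(2)] by blast
  then have "cl (convex hull A) \<subseteq> cl Z"
    using Z(3) by (intro cl_minimal clos_cl) (simp add: subset_hull)
  then show ?thesis using Z(1) by (auto simp: sep_def)
qed

end

context complete_norm
begin

section \<open>Weak sequential compactness of separable convex sets\<close>

lemma nested_antimono: "nested H \<Longrightarrow> m \<le> n \<Longrightarrow> H n \<subseteq> H m"
  by (rule lift_Suc_antimono_le[of H]) (auto simp: nested_def)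

lemma nested_Int: "nested H \<Longrightarrow> convex A \<Longrightarrow> clos A \<Longrightarrow> nested (\<lambda>n. H n \<inter> A)"
  by (auto simp: nested_def convex_Int clos_Int)

text \<open>If \<open>k\<close> is within \<open>e / 2\<close> of every \<open>C n\<close> in the
  seminorm \<open>q\<close>, cutting each \<open>C n\<close> with that ball about \<open>k\<close>
  leaves a nested sequence of nonempty sets of \<open>q\<close>-diameter at most \<open>e\<close>.
  Doing this for the finitely many seminorms in turn makes the norm diameter small, and completeness
  gives a common point. The centre may depend on \<open>q\<close>, which is what the componentwise
  measure requires.\<close>

lemma wfip_finite_seminorms:
  assumes fin: "finite Q"
    and Q: "\<And>q x y. q \<in> Q \<Longrightarrow> q (x + y) \<le> q x + q y"
      "\<And>q c x. q \<in> Q \<Longrightarrow> q (c *\<^sub>R x) = \<bar>c\<bar> * q x"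
      "\<And>q x. q \<in> Q \<Longrightarrow> q x \<le> nrm x"
    and Qmax: "\<And>x. \<exists>q\<in>Q. nrm x \<le> q x"
    and M: "convex M" "clos M"
    and centre: "\<And>q e C. q \<in> Q \<Longrightarrow> 0 < e \<Longrightarrow> nested C \<Longrightarrow> (\<And>n. C n \<noteq> {} \<and> C n \<subseteq> M)
      \<Longrightarrow> \<exists>k. \<forall>n. \<exists>c\<in>C n. q (c - k) \<le> e"
  shows "wfip M"
proof -
  define good where "good C \<longleftrightarrow> nested C \<and> (\<forall>n. C n \<noteq> {} \<and> C n \<subseteq> M)" for C
  have shrink: "\<exists>D. good D \<and> (\<forall>n. D n \<subseteq> C n) \<and> (\<forall>q\<in>F. \<forall>x\<in>D 0. \<forall>y\<in>D 0. q (x - y) \<le> e)"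
    if F: "finite F" "F \<subseteq> Q" and C: "good C" and e: "0 < e" for F C e
    using F
  proof (induction F)
    case empty
    then show ?case using C by blast
  next
    case (insert q F)
    then obtain D where D: "good D" "\<forall>n. D n \<subseteq> C n" "\<forall>q\<in>F. \<forall>x\<in>D 0. \<forall>y\<in>D 0. q (x - y) \<le> e"
      by auto
    have q: "q \<in> Q" using insert by simp
    obtain k where k: "\<forall>n. \<exists>c\<in>D n. q (c - k) \<le> e / 2"
      using centre[OF q half_gt_zero[OF e], of D] D(1) by (auto simp: good_def)
    define E where "E n = D n \<inter> {x. q (x - k) \<le> e / 2}" for n
    have "nested E"
      unfolding E_def using D(1)
      by (intro nested_Int convex_seminorm_le clos_seminorm_le Q[OF q]) (auto simp: good_def)
    moreover have "E n \<noteq> {}" for n using k by (auto simp: E_def)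
    moreover have "E n \<subseteq> M" for n using D(1) by (auto simp: E_def good_def)
    ultimately have "good E" by (auto simp: good_def)
    moreover have "q (x - y) \<le> e" if "x \<in> E 0" "y \<in> E 0" for x y
    proof -
      have "q (y - k) = q (k - y)" using Q(2)[OF q, of "- 1" "y - k"] by simp
      then show ?thesis using that Q(1)[OF q, of "x - k" "k - y"] by (auto simp: E_def)
    qed
    moreover have "E n \<subseteq> D n" for n by (auto simp: E_def)
    ultimately show ?case using D
      by (intro exI[of _ E]) (auto 0 4 simp: subset_iff)
  qed
  have shrink': "\<exists>D. good D \<and> (\<forall>n. D n \<subseteq> C n) \<and> (\<forall>x\<in>D 0. \<forall>y\<in>D 0. nrm (x - y) \<le> e)"
    if C: "good C" and e: "0 < e" for C e
  proof -
    obtain D where D: "good D" "\<forall>n. D n \<subseteq> C n" "\<forall>q\<in>Q. \<forall>x\<in>D 0. \<forall>y\<in>D 0. q (x - y) \<le> e"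
      using shrink[OF fin order_refl C e] by blast
    have "nrm (x - y) \<le> e" if "x \<in> D 0" "y \<in> D 0" for x y
      using Qmax[of "x - y"] D(3) that by (meson order_trans)
    then show ?thesis using D by blast
  qed
  show ?thesis
    unfolding wfip_def
  proof (intro allI impI)
    fix H assume H: "nested H" "\<forall>n. M \<inter> H n \<noteq> {}"
    define C where "C n = H n \<inter> M" for n
    have gC: "good C"
      unfolding good_def C_def using nested_Int[OF H(1) M] H(2) by (auto simp: Int_commute)
      \<comment> \<open>Stage \<open>s\<close> is a whole sequence of sets. The clause for
        \<open>s = 0\<close> anchors the construction at \<open>C\<close>.\<close>
      have "\<exists>D. \<forall>s. (good (D s) \<and> (s = 0 \<longrightarrow> D s = C)) \<and> ((\<forall>n. D (Suc s) n \<subseteq> D s n) \<and>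
        (\<forall>x\<in>D (Suc s) 0. \<forall>y\<in>D (Suc s) 0. nrm (x - y) \<le> (1/2) ^ s))"
      proof (rule dependent_nat_choice)
        show "\<exists>D. good D \<and> (0 = 0 \<longrightarrow> D = C)" using gC by blast
      next
        fix D' :: "nat \<Rightarrow> 'a set" and s :: nat
        assume "good D' \<and> (s = 0 \<longrightarrow> D' = C)"
        then obtain D where "good D" "\<forall>n. D n \<subseteq> D' n" "\<forall>x\<in>D 0. \<forall>y\<in>D 0. nrm (x - y) \<le> (1/2) ^ s"
          using shrink'[of D' "(1/2) ^ s"] by auto
        then show "\<exists>D. (good D \<and> (Suc s = 0 \<longrightarrow> D = C)) \<and> ((\<forall>n. D n \<subseteq> D' n) \<and>
            (\<forall>x\<in>D 0. \<forall>y\<in>D 0. nrm (x - y) \<le> (1/2) ^ s))"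
          by blast
      qed
    then obtain D where D': "\<And>s. (good (D s) \<and> (s = 0 \<longrightarrow> D s = C)) \<and> ((\<forall>n. D (Suc s) n \<subseteq> D s n) \<and>
        (\<forall>x\<in>D (Suc s) 0. \<forall>y\<in>D (Suc s) 0. nrm (x - y) \<le> (1/2) ^ s))"
      by blast
    have D: "\<And>s. good (D s)" "\<And>s n. D (Suc s) n \<subseteq> D s n"
        "\<And>s x y. x \<in> D (Suc s) 0 \<Longrightarrow> y \<in> D (Suc s) 0 \<Longrightarrow> nrm (x - y) \<le> (1/2) ^ s" "D 0 = C"
      using D' by blast+
    have D_le: "D s n \<subseteq> D s' n'" if "s' \<le> s" "n' \<le> n" for s s' n n'
    proof -
      have "D s n \<subseteq> D s n'" using nested_antimono[of "D s"] D(1) that(2) by (simp add: good_def)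
      also have "\<dots> \<subseteq> D s' n'"
        using lift_Suc_antimono_le[where f = "\<lambda>s. D s n'", OF _ that(1)] D(2) by simp
      finally show ?thesis .
    qed
    \<comment> \<open>The diagonal point \<open>z s\<close> lies in \<open>D s' n'\<close> for all
      \<open>s'\<close> and \<open>n'\<close> up to \<open>s\<close>: the first index makes
      \<open>z\<close> a Cauchy sequence, the second puts its limit into every
      \<open>C n\<close>.\<close>
    have "\<forall>s. \<exists>z. z \<in> D s s" using D(1) unfolding good_def by blast
    from choice[OF this] obtain z where z: "\<And>s. z s \<in> D s s" by blast
    have "\<exists>x. (\<lambda>n. nrm (z n - x)) \<longlonglongrightarrow> 0"
    proof (rule nrm_complete)
      fix e :: real assume "0 < e"
      then obtain s where s: "(1/2) ^ s < e" using real_arch_pow_inv[of e "1/2"] by auto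
      have "nrm (z m - z n) < e" if "Suc s \<le> m" "Suc s \<le> n" for m n
        using D(3)[of "z m" s "z n"] z[of m] z[of n] D_le[of "Suc s" m 0 m] D_le[of "Suc s" n 0 n]
          that s by force
      then show "\<exists>k. \<forall>m\<ge>k. \<forall>n\<ge>k. nrm (z m - z n) < e" by blast
    qed
    then obtain x where x: "(\<lambda>n. nrm (z n - x)) \<longlonglongrightarrow> 0" by blast
    have "x \<in> C n" for n
    proof (rule clos_limit)
      show "clos (C n)" using gC by (auto simp: good_def nested_def)
      show "\<forall>m. z (m + n) \<in> C n" using z D_le[of 0 _ n] D(4) by (metis le0 le_add2 subsetD)
      show "(\<lambda>m. nrm (z (m + n) - x)) \<longlonglongrightarrow> 0" by (rule LIMSEQ_ignore_initial_segment[OF x])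
    qed
    then show "\<exists>x\<in>M. \<forall>n. x \<in> H n" by (auto simp: C_def)
  qed
qed

section \<open>Smulian's theorem\<close>

text \<open>The common point of the closed hulls of the tails stands in for a weak cluster point of
  \<open>v\<close>.\<close>

lemma wfip_tails:
  assumes "wfip M" "\<And>n. v n \<in> M"
  obtains x where "x \<in> M" "\<And>n::nat. x \<in> cl (convex hull (v ` {n..}))"
proof -
  let ?H = "\<lambda>n. cl (convex hull (v ` {n..}))"
  have "nested ?H"
    unfolding nested_def
    by (intro allI conjI convex_cl convex_convex_hull clos_cl cl_mono hull_mono image_mono) auto
  moreover have "M \<inter> ?H n \<noteq> {}" for n
    using assms(2)[of n] subset_cl[of "convex hull (v ` {n..})"] hull_subset[of "v ` {n..}" convex]
    by auto
  ultimately have "\<exists>x\<in>M. \<forall>n. x \<in> ?H n"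
    using assms(1)[unfolded wfip_def, rule_format, of ?H] by blast
  then show ?thesis using that by blast
qed

text \<open>The closed half-space where \<open>f\<close> is at least \<open>l - e\<close> contains a
  tail of \<open>v\<close>, hence its closed hull; \<open>- f\<close> gives the other
  inequality.\<close>

lemma tails_limit:
  assumes "\<And>n::nat. x \<in> cl (convex hull (v ` {n..}))" "dual f" "(\<lambda>n. f (v n)) \<longlonglongrightarrow> l"
  shows "f x = l"
proof -
  have ge: "l \<le> f x" if f: "dual f" and l: "(\<lambda>n. f (v n)) \<longlonglongrightarrow> l" for f l
  proof (rule field_le_epsilon)
    fix e :: real assume "0 < e"
    then obtain n where n: "\<And>k. n \<le> k \<Longrightarrow> l - e < f (v k)"
      using order_tendstoD(1)[OF l, of "l - e"] by (auto simp: eventually_sequentially)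
    have "cl (convex hull (v ` {n..})) \<subseteq> {y. l - e \<le> f y}"
      by (intro cl_minimal hull_minimal convex_dual_ge clos_dual_ge f)
        (use n in \<open>auto intro: less_imp_le\<close>)
    then show "l \<le> f x + e" using assms(1)[of n] by auto
  qed
  show ?thesis
    using ge[OF assms(2,3)] ge[OF dual_uminus[OF assms(2)] tendsto_minus[OF assms(3)]] by simp
qed

text \<open>Functionals norming the differences of points of a dense set suffice: if
  \<open>a\<close> and \<open>b\<close> are within a quarter of the distance of \<open>x\<close> and
  \<open>y\<close>, a functional norming \<open>a - b\<close> cannot agree at \<open>x\<close> and
  \<open>y\<close>.\<close>

lemma countable_separating:
  assumes "sep M"
  obtains F where "countable F" "F \<noteq> {}" "\<And>f. f \<in> F \<Longrightarrow> dual f"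
    and "\<And>x y. x \<in> M \<Longrightarrow> y \<in> M \<Longrightarrow> (\<And>f. f \<in> F \<Longrightarrow> f x = f y) \<Longrightarrow> x = y"
proof -
  obtain Z where Z: "countable Z" "M \<subseteq> cl Z" using assms by (auto simp: sep_def)
  have "\<forall>z. \<exists>f. dual f \<and> f z = nrm z" using norming by metis
  from choice[OF this] obtain \<phi> where \<phi>: "\<And>z. dual (\<phi> z)" "\<And>z. \<phi> z z = nrm z" by blast
  \<comment> \<open>The member \<open>\<phi> 0\<close> keeps \<open>F\<close> nonempty, so that it
    can be enumerated later.\<close>
  define F where "F = insert (\<phi> 0) ((\<lambda>(a, b). \<phi> (a - b)) ` (Z \<times> Z))"
  have "x = y" if xy: "x \<in> M" "y \<in> M" "\<And>f. f \<in> F \<Longrightarrow> f x = f y" for x y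
  proof (rule ccontr)
    assume "x \<noteq> y"
    then have d: "0 < nrm (x - y) / 4" using nrm_pos by simp
    obtain a b where ab: "a \<in> Z" "nrm (a - x) < nrm (x - y) / 4" "b \<in> Z" "nrm (b - y) < nrm (x - y) / 4"
      using xy(1,2) Z(2) d unfolding cl_def by blast
    let ?f = "\<phi> (a - b)"
    have "?f x = ?f y" using ab by (intro xy(3)) (auto simp: F_def)
    moreover have "?f a - ?f x \<le> nrm (a - x)" "?f y - ?f b \<le> nrm (y - b)"
      using dual_abs[OF \<phi>(1)[of "a - b"]] dual_diff[OF \<phi>(1)[of "a - b"]] by (metis abs_le_D1)+
    moreover have "?f a - ?f b = nrm (a - b)"
      using \<phi>(2)[of "a - b"] dual_diff[OF \<phi>(1)[of "a - b"]] by simp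
    moreover have "nrm (x - y) \<le> nrm (x - a) + (nrm (a - b) + nrm (b - y))"
      using nrm_triangle[of x y a] nrm_triangle[of a y b] by linarith
    ultimately show False
      using ab nrm_commute[of x a] nrm_commute[of y b] d by linarith
  qed
  moreover have "countable F" "F \<noteq> {}" "\<And>f. f \<in> F \<Longrightarrow> dual f"
    using Z(1) \<phi>(1) by (auto simp: F_def)
  ultimately show ?thesis using that[of F] by blast
qed

text \<open>A diagonal subsequence converges under a countable separating family \<open>F\<close>,
  and \<open>x\<close> is a common point of its tail hulls. If some \<open>g\<close> did not
  converge to \<open>g x\<close>, a further subsequence would stay away from \<open>g x\<close>
  while \<open>g\<close> converges on it. A common point of its tail hulls has the same values under
  \<open>F\<close> as \<open>x\<close>, hence is \<open>x\<close>, and \<open>tails_limit\<close>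
  gives a contradiction.\<close>

theorem wfip_imp_wseq:
  assumes M: "sep M" "wfip M" and B: "\<And>x. x \<in> M \<Longrightarrow> nrm x \<le> B"
  shows "wseq M"
  unfolding wseq_def
proof (intro allI impI)
  fix u :: "nat \<Rightarrow> 'a" assume u: "\<forall>n. u n \<in> M"
  obtain F where F: "countable F" "\<And>f. f \<in> F \<Longrightarrow> dual f"
      "\<And>x y. x \<in> M \<Longrightarrow> y \<in> M \<Longrightarrow> (\<And>f. f \<in> F \<Longrightarrow> f x = f y) \<Longrightarrow> x = y"
    using countable_separating[OF M(1)] by metis
  have bound: "norm (f (u n)) \<le> B" if "dual f" for f n
    using dual_abs[OF that, of "u n"] B[of "u n"] u by simp
  obtain k where k: "strict_mono k" "\<And>f. f \<in> F \<Longrightarrow> \<exists>l. (\<lambda>n. f (u (k n))) \<longlonglongrightarrow> l"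
    using function_convergent_subsequence[OF F(1), of "\<lambda>n f. f (u n)" B] bound F(2) by blast
  obtain x where x: "x \<in> M" "\<And>n. x \<in> cl (convex hull ((\<lambda>n. u (k n)) ` {n..}))"
    using wfip_tails[OF M(2), of "\<lambda>n. u (k n)"] u by blast
  have "(\<lambda>n. g (u (k n))) \<longlonglongrightarrow> g x" if g: "dual g" for g
  proof (rule ccontr)
    assume "\<not> ?thesis"
    then obtain e where e: "0 < e" "\<exists>\<^sub>F n in sequentially. \<not> dist (g (u (k n))) (g x) < e"
      unfolding tendsto_iff by (auto simp: not_eventually)
    then have "infinite {n. \<not> dist (g (u (k n))) (g x) < e}"
      by (simp add: frequently_cofinite cofinite_eq_sequentially[symmetric])
    then obtain r :: "nat \<Rightarrow> nat" where r: "strict_mono r" "\<And>n. \<not> dist (g (u (k (r n)))) (g x) < e"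
      using infinite_enumerate by blast
    obtain s where s: "strict_mono s" "\<exists>l. (\<lambda>n. g (u (k (r (s n))))) \<longlonglongrightarrow> l"
      using function_convergent_subsequence[of "{g}" "\<lambda>n f. f (u (k (r n)))" B] bound[OF g] by auto
    then obtain l where l: "(\<lambda>n. g (u (k (r (s n))))) \<longlonglongrightarrow> l" by blast
    obtain y where y: "y \<in> M" "\<And>n. y \<in> cl (convex hull ((\<lambda>n. u (k (r (s n)))) ` {n..}))"
      using wfip_tails[OF M(2), of "\<lambda>n. u (k (r (s n)))"] u by blast
    have "f y = f x" if f: "f \<in> F" for f
    proof -
      obtain a where a: "(\<lambda>n. f (u (k n))) \<longlonglongrightarrow> a" using k(2)[OF f] by blast
      have "(\<lambda>n. f (u (k (r (s n))))) \<longlonglongrightarrow> a"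
        using LIMSEQ_subseq_LIMSEQ[OF a strict_mono_o[OF r(1) s(1)]] by (simp add: o_def)
      then show ?thesis using tails_limit[OF x(2) F(2)[OF f] a] tails_limit[OF y(2) F(2)[OF f]] by simp
    qed
    then have "y = x" using F(3) x(1) y(1) by blast
    then have "l = g x" using tails_limit[OF y(2) g l] by simp
    then have "\<forall>\<^sub>F n in sequentially. dist (g (u (k (r (s n))))) (g x) < e"
      using l e(1) by (simp add: tendsto_iff)
    then show False using r(2) by (auto simp: eventually_sequentially)
  qed
  then show "\<exists>x\<in>M. \<exists>r. strict_mono (r :: nat \<Rightarrow> nat) \<and> wlim (u \<circ> r) x"
    using x(1) k(1) unfolding wlim_def o_def by blast
qed

end

section \<open>Convex hulls of weakly compact sets\<close>

lemma half_powers_sums: "(\<lambda>i. (1/2::real) ^ Suc i * c) sums c"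
  using sums_mult2[OF power_half_series, of c] by simp

lemma half_powers_summable:
  fixes a :: "nat \<Rightarrow> real"
  assumes "\<And>i. \<bar>a i\<bar> \<le> c"
  shows "summable (\<lambda>i. (1/2) ^ Suc i * a i)"
proof (rule summable_comparison_test)
  show "\<exists>N. \<forall>i\<ge>N. norm ((1/2) ^ Suc i * a i) \<le> (1/2) ^ Suc i * c"
    using assms by (auto simp: abs_mult intro!: exI[of _ 0])
  show "summable (\<lambda>i. (1/2) ^ Suc i * c)"
    using half_powers_sums by (rule sums_summable)
qed

lemma half_powers_le:
  fixes a :: "nat \<Rightarrow> real"
  assumes "\<And>i. \<bar>a i\<bar> \<le> c" "\<And>i. a i \<le> b"
  shows "(\<Sum>i. (1/2) ^ Suc i * a i) \<le> b"
proof -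
  have "(\<Sum>i. (1/2) ^ Suc i * a i) \<le> (\<Sum>i. (1/2) ^ Suc i * b)"
    using assms half_powers_sums
    by (intro suminf_le half_powers_summable[of a c] mult_left_mono) (auto simp: sums_iff)
  also have "\<dots> = b" using half_powers_sums by (rule sums_unique[symmetric])
  finally show ?thesis .
qed

context complete_norm
begin

lemma cl_empty [simp]: "cl {} = {}"
  by (auto simp: cl_def intro: exI[of _ 1])

text \<open>The dual unit ball admits infinite convex combinations, the stability that Simons'
  inequality asks for.\<close>

lemma dual_half_powers:
  assumes h: "\<And>i::nat. dual (h i)"
  shows "dual (\<lambda>x. \<Sum>i. (1/2) ^ Suc i * h i x)"
  unfolding dual_def
proof (intro conjI allI)
  have s: "summable (\<lambda>i. (1/2) ^ Suc i * h i x)" for x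
    by (rule half_powers_summable[of _ "nrm x"]) (rule dual_abs[OF h])
  show "linear (\<lambda>x. \<Sum>i. (1/2) ^ Suc i * h i x)"
  proof (rule linearI)
    fix x y
    have "(\<Sum>i. (1/2) ^ Suc i * h i (x + y)) = (\<Sum>i. (1/2) ^ Suc i * h i x + (1/2) ^ Suc i * h i y)"
      by (simp only: dual_add[OF h] distrib_left)
    also have "\<dots> = (\<Sum>i. (1/2) ^ Suc i * h i x) + (\<Sum>i. (1/2) ^ Suc i * h i y)"
      by (rule suminf_add[OF s s, symmetric])
    finally show "(\<Sum>i. (1/2) ^ Suc i * h i (x + y))
        = (\<Sum>i. (1/2) ^ Suc i * h i x) + (\<Sum>i. (1/2) ^ Suc i * h i y)" .
  next
    fix c x
    have "(\<Sum>i. (1/2) ^ Suc i * h i (c *\<^sub>R x)) = (\<Sum>i. c * ((1/2) ^ Suc i * h i x))"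
      by (simp add: dual_scale[OF h] ac_simps)
    also have "\<dots> = c * (\<Sum>i. (1/2) ^ Suc i * h i x)" by (rule suminf_mult[OF s])
    finally show "(\<Sum>i. (1/2) ^ Suc i * h i (c *\<^sub>R x)) = c *\<^sub>R (\<Sum>i. (1/2) ^ Suc i * h i x)" by simp
  qed
  show "(\<Sum>i. (1/2) ^ Suc i * h i x) \<le> nrm x" for x
    by (rule half_powers_le[of _ "nrm x"]) (use dual_abs[OF h] h in \<open>auto simp: dual_def\<close>)
qed

text \<open>The slices of \<open>K\<close> on which \<open>g\<close> is within
  \<open>1/(n+1)\<close> of its supremum are cut out by nested closed half-spaces; a common point is
  a maximiser.\<close>

lemma wfip_attains_max:
  assumes K: "wfip K" "K \<noteq> {}" and B: "\<And>x. x \<in> K \<Longrightarrow> nrm x \<le> B" and g: "dual g"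
  obtains b where "b \<in> K" "\<And>x. x \<in> K \<Longrightarrow> g x \<le> g b"
proof -
  have bdd: "bdd_above (g ` K)"
  proof (rule bdd_aboveI2)
    fix x assume "x \<in> K"
    then show "g x \<le> B" using B[of x] dual_abs[OF g, of x] by simp
  qed
  define s where "s = (SUP x\<in>K. g x)"
  have s: "g x \<le> s" if "x \<in> K" for x
    unfolding s_def by (rule cSUP_upper[OF that bdd])
  define H where "H n = {x. s - inverse (real (Suc n)) \<le> g x}" for n
  have "nested H"
    unfolding nested_def
  proof (intro allI conjI)
    fix n
    show "convex (H n)" "clos (H n)" unfolding H_def by (rule convex_dual_ge clos_dual_ge g)+
    have "inverse (real (Suc (Suc n))) \<le> inverse (real (Suc n))" by (simp add: field_simps)
    then show "H (Suc n) \<subseteq> H n" unfolding H_def by (intro Collect_mono impI) linarith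
  qed
  moreover have "K \<inter> H n \<noteq> {}" for n
  proof -
    have "s - inverse (real (Suc n)) < s" by simp
    then obtain x where "x \<in> K" "s - inverse (real (Suc n)) < g x"
      unfolding s_def using less_cSUP_iff[OF K(2) bdd] by blast
    then show ?thesis by (auto simp: H_def)
  qed
  ultimately obtain b where b: "b \<in> K" "\<And>n. b \<in> H n"
    using K(1)[unfolded wfip_def, rule_format, of H] by blast
  have "s \<le> g b"
  proof (rule field_le_epsilon)
    fix e :: real assume "0 < e"
    then obtain n where "inverse (real (Suc n)) < e" using reals_Archimedean by blast
    then show "s \<le> g b + e" using b(2)[of n] by (simp add: H_def)
  qed
  then show ?thesis using that[OF b(1)] s by (meson order_trans)
qed

lemma nrm_sum: "finite A \<Longrightarrow> nrm (\<Sum>i\<in>A. v i) \<le> (\<Sum>i\<in>A. nrm (v i))"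
proof (induction A rule: finite_induct)
  case (insert i A)
  then show ?case using nrm_add[of "v i" "sum v A"] by simp
qed simp

text \<open>The hull of a finite set is norm compact. Were it within \<open>e / 2\<close> of every
  \<open>C m\<close>, the coefficients of the nearby hull points would converge along a subsequence,
  and the limiting hull point \<open>b\<close> would be within \<open>e\<close> of points
  arbitrarily far out in \<open>C\<close>.\<close>

lemma nested_far_from_finite_hull:
  assumes C: "nested C" and far: "\<And>k. \<exists>n. \<forall>c\<in>C n. e < nrm (c - k)" and A: "finite A" and e: "0 < e"
  shows "\<exists>m. \<forall>c\<in>C m. \<forall>a\<in>convex hull A. e / 2 \<le> nrm (c - a)"
proof (rule ccontr)
  assume "\<not> ?thesis"
  then have "\<forall>m. \<exists>c a. c \<in> C m \<and> a \<in> convex hull A \<and> nrm (c - a) < e / 2"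
    by (simp add: not_le) blast
  then obtain c a where ca: "\<And>m. c m \<in> C m" "\<And>m. a m \<in> convex hull A" "\<And>m. nrm (c m - a m) < e / 2"
    by metis
  have "\<forall>m. \<exists>w. (\<forall>x\<in>A. 0 \<le> w x) \<and> sum w A = 1 \<and> (\<Sum>x\<in>A. w x *\<^sub>R x) = a m"
    using ca(2) unfolding convex_hull_finite[OF A] by blast
  from choice[OF this] obtain w where w: "\<And>m x. x \<in> A \<Longrightarrow> 0 \<le> w m x" "\<And>m. sum (w m) A = 1"
      "\<And>m. (\<Sum>x\<in>A. w m x *\<^sub>R x) = a m" by blast
  have "norm (w m x) \<le> 1" if "x \<in> A" for m x
    using member_le_sum[OF that, of "w m"] w(1,2) A that by simp
  then obtain k where k: "strict_mono k" "\<And>x. x \<in> A \<Longrightarrow> \<exists>l. (\<lambda>m. w (k m) x) \<longlonglongrightarrow> l"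
    using function_convergent_subsequence[OF countable_finite[OF A], of w 1] by blast
  have "\<forall>x. \<exists>l. x \<in> A \<longrightarrow> (\<lambda>m. w (k m) x) \<longlonglongrightarrow> l" using k(2) by blast
  from choice[OF this] obtain l where l: "\<And>x. x \<in> A \<Longrightarrow> (\<lambda>m. w (k m) x) \<longlonglongrightarrow> l x" by blast
  define b where "b = (\<Sum>x\<in>A. l x *\<^sub>R x)"
  have "(\<lambda>m. \<Sum>x\<in>A. \<bar>w (k m) x - l x\<bar> * nrm x) \<longlonglongrightarrow> (\<Sum>x\<in>A. \<bar>l x - l x\<bar> * nrm x)"
    using l by (intro tendsto_intros) auto
  then have "(\<lambda>m. \<Sum>x\<in>A. \<bar>w (k m) x - l x\<bar> * nrm x) \<longlonglongrightarrow> 0" by simp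
  then obtain m0 where m0: "\<And>m. m0 \<le> m \<Longrightarrow> (\<Sum>x\<in>A. \<bar>w (k m) x - l x\<bar> * nrm x) < e / 2"
    using order_tendstoD(2)[of _ 0 sequentially "e / 2"] e by (auto simp: eventually_sequentially)
  obtain n where n: "\<forall>c\<in>C n. e < nrm (c - b)" using far by blast
  let ?m = "max m0 n"
  have "nrm (a (k ?m) - b) \<le> (\<Sum>x\<in>A. \<bar>w (k ?m) x - l x\<bar> * nrm x)"
    using nrm_sum[OF A, of "\<lambda>x. (w (k ?m) x - l x) *\<^sub>R x"]
    by (simp add: w(3)[symmetric] b_def sum_subtractf[symmetric] scaleR_diff_left[symmetric] nrm_scale
        del: scaleR_diff_left)
  also have "\<dots> < e / 2" by (rule m0) simp
  finally have "nrm (c (k ?m) - b) < e"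
    using nrm_triangle[of "c (k ?m)" b "a (k ?m)"] ca(3)[of "k ?m"] by linarith
  moreover have "n \<le> k ?m" using seq_suble[OF k(1), of ?m] by simp
  then have "c (k ?m) \<in> C n" using ca(1)[of "k ?m"] nested_antimono[OF C] by blast
  ultimately show False using n by fastforce
qed

text \<open>If no point came within \<open>e\<close> of all the sets \<open>C n\<close>, separating them from larger and larger
  finite hulls would give functionals that tend to \<open>0\<close> on \<open>K\<close> but stay above \<open>e / 2\<close> far out in
  \<open>C\<close>, against Simons' inequality.\<close>

lemma hull_asymptotic_centre:
  assumes K: "sep K" "wfip K" and B: "\<And>x. x \<in> K \<Longrightarrow> nrm x \<le> B"
    and C: "nested C" "\<And>n. C n \<noteq> {}" "\<And>n. C n \<subseteq> cl (convex hull K)" and e: "0 < e"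
  shows "\<exists>k. \<forall>n. \<exists>c\<in>C n. nrm (c - k) \<le> e"
proof (rule ccontr)
  assume "\<not> ?thesis"
  then have far: "\<exists>n. \<forall>c\<in>C n. e < nrm (c - k)" for k by (auto simp: not_le)
  define M where "M = cl (convex hull K)"
  have hull_le: "M \<subseteq> {x. g x \<le> a}" if "dual g" "\<And>x. x \<in> K \<Longrightarrow> g x \<le> a" for g a
  proof -
    have "{x. - a \<le> - g x} = {x. g x \<le> a}" by auto
    then have "convex {x. g x \<le> a}" "clos {x. g x \<le> a}"
      using convex_dual_ge[OF dual_uminus[OF that(1)], of "- a"]
        clos_dual_ge[OF dual_uminus[OF that(1)], of "- a"] by (simp_all only:)
    then show ?thesis
      unfolding M_def using that(2) by (intro cl_minimal hull_minimal) auto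
  qed
  have "K \<noteq> {}"
    using C(2,3)[of 0] by auto
  have BM: "nrm x \<le> B" if "x \<in> M" for x
  proof -
    obtain f where f: "dual f" "f x = nrm x" using norming by blast
    have "M \<subseteq> {x. f x \<le> B}"
      by (rule hull_le[OF f(1)]) (use B f(1) in \<open>auto simp: dual_def intro: order_trans\<close>)
    then show ?thesis using that f(2) by auto
  qed
  then have BC: "nrm c \<le> B" if "c \<in> C n" for c n using C(3) that M_def by blast
  obtain Z where Z: "countable Z" "Z \<subseteq> K" "K \<subseteq> cl Z" using sep_dense[OF K(1)] .
  \<comment> \<open>All integer multiples of the dense set are listed: a bound by \<open>B\<close>
    on \<open>real n *\<^sub>R z\<close> for large \<open>n\<close> forces a functional to be small
    at \<open>z\<close>.\<close>
  define Y where "Y = (\<lambda>(n::nat, z). real n *\<^sub>R z) ` (UNIV \<times> Z)"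
  have "Z \<noteq> {}" using Z(3) \<open>K \<noteq> {}\<close> by auto
  then have Y: "countable Y" "Y \<noteq> {}" using Z(1) by (auto simp: Y_def)
  define y where "y = from_nat_into Y"
  \<comment> \<open>The slack \<open>d\<close> makes the last condition stable under infinite convex
    combinations, for which a single \<open>m\<close> common to all summands may fail to
    exist.\<close>
  define G where "G n = {g. dual g \<and> (\<forall>i\<le>n. g (y i) \<le> B) \<and> (\<forall>d>0. \<exists>m. \<forall>c\<in>C m. e / 2 - d \<le> g c)}"
    for n
  have Gd: "dual g" if "g \<in> G n" for g n using that by (simp add: G_def)
  have "G n \<noteq> {}" for n
  proof -
    \<comment> \<open>The point \<open>0\<close> yields \<open>e / 2 \<le> f c\<close>, and the
      points \<open>y i\<close> yield \<open>f (y i) \<le> f c \<le> B\<close>.\<close>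
    let ?A = "insert 0 (y ` {..n})"
    obtain m where m: "\<forall>c\<in>C m. \<forall>a\<in>convex hull ?A. e / 2 \<le> nrm (c - a)"
      using nested_far_from_finite_hull[OF C(1) far _ e, of ?A] by auto
    have "convex (\<Union>c\<in>C m. \<Union>a\<in>convex hull ?A. {c - a})"
      using C(1) by (intro convex_differences) (auto simp: nested_def)
    then obtain f where f: "dual f" "\<And>v. v \<in> (\<Union>c\<in>C m. \<Union>a\<in>convex hull ?A. {c - a}) \<Longrightarrow> e / 2 \<le> f v"
      using separation[of _ "e / 2"] m by (metis (no_types, lifting) UN_E singletonD)
    have fca: "e / 2 \<le> f c - f a" if "c \<in> C m" "a \<in> ?A" for c a
    proof -
      have "a \<in> convex hull ?A" using that(2) by (rule hull_inc)
      then have "e / 2 \<le> f (c - a)" using that(1) by (intro f(2)) blast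
      then show ?thesis by (simp only: dual_diff[OF f(1)])
    qed
    have "f (y i) \<le> B" if "i \<le> n" for i
    proof -
      obtain c where c: "c \<in> C m" using C(2) by blast
      have "f c \<le> B" using BC[OF c] dual_abs[OF f(1), of c] by simp
      then show ?thesis using fca[OF c, of "y i"] that e by simp
    qed
    moreover have "e / 2 - d \<le> f c" if "0 < d" "c \<in> C m" for c d
      using fca[OF that(2), of 0] that(1) linear_0[OF dual_linear[OF f(1)]] by simp
    ultimately have "f \<in> G n" using f(1) unfolding G_def by blast
    then show ?thesis by blast
  qed
  moreover have "G (Suc n) \<subseteq> G n" for n by (auto simp: G_def)
  moreover have "(\<lambda>x. \<Sum>i. (1/2) ^ Suc i * h i x) \<in> G n" if h: "\<And>i. h i \<in> G n" for h n
  proof -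
    let ?g = "\<lambda>x. \<Sum>i. (1/2) ^ Suc i * h i x"
    have hd: "dual (h i)" for i using Gd h .
    have "?g (y j) \<le> B" if "j \<le> n" for j
      by (rule half_powers_le[of _ "nrm (y j)"]) (use dual_abs[OF hd] h that in \<open>auto simp: G_def\<close>)
    moreover have "\<exists>m. \<forall>c\<in>C m. e / 2 - d \<le> ?g c" if d: "0 < d" for d
    proof -
      obtain c0 where "c0 \<in> C 0" using C(2) by blast
      then have B0: "0 \<le> B" using BC[of c0 0] nrm_ge_0[of c0] by linarith
      \<comment> \<open>Half of \<open>d\<close> is spent on the first \<open>n0\<close> summands.
        The other half pays for the tail of weight \<open>(1/2) ^ n0\<close>, where the values may
        be as low as \<open>- B\<close> instead of \<open>e / 2\<close>.\<close>
      have pos: "0 < d / 2 / (e / 2 + B)" using d e B0 by simp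
      obtain n0 where n0: "(1/2) ^ n0 < d / 2 / (e / 2 + B)"
        using real_arch_pow_inv[OF pos, of "1/2"] by auto
      then have n0: "(1/2) ^ n0 * (e / 2 + B) < d / 2"
        by (subst (asm) pos_less_divide_eq) (use e B0 in auto)
      have "\<forall>i. \<exists>m. \<forall>c\<in>C m. e / 2 - d / 2 \<le> h i c"
        using h half_gt_zero[OF d] unfolding G_def by blast
      from choice[OF this] obtain \<mu> where \<mu>: "\<And>i c. c \<in> C (\<mu> i) \<Longrightarrow> e / 2 - d / 2 \<le> h i c" by blast
      define m where "m = Max (\<mu> ` {..<Suc n0})"
      have "e / 2 - d \<le> ?g c" if c: "c \<in> C m" for c
      proof -
        have habs: "\<bar>h i c\<bar> \<le> B" for i using dual_abs[OF hd, of i c] BC[OF c] by simp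
        have s: "summable (\<lambda>i. (1/2) ^ Suc i * h i c)" by (rule half_powers_summable[OF habs])
        have geo: "(\<Sum>i<n0. (1/2::real) ^ Suc i) = 1 - (1/2) ^ n0"
          by (induction n0) auto
        have "(1 - (1/2) ^ n0) * (e / 2 - d / 2) = (\<Sum>i<n0. (1/2) ^ Suc i * (e / 2 - d / 2))"
          by (simp only: geo[symmetric] sum_distrib_right)
        also have "\<dots> \<le> (\<Sum>i<n0. (1/2) ^ Suc i * h i c)"
        proof (intro sum_mono mult_left_mono \<mu>)
          fix i assume "i \<in> {..<n0}"
          then have "\<mu> i \<le> m" unfolding m_def by (intro Max_ge) auto
          then show "c \<in> C (\<mu> i)" using nested_antimono[OF C(1)] c by blast
        qed simp
        finally have 1: "(1 - (1/2) ^ n0) * (e / 2 - d / 2) \<le> (\<Sum>i<n0. (1/2) ^ Suc i * h i c)" .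
        have "(\<Sum>i. (1/2) ^ Suc i * - h (i + n0) c) \<le> B"
          by (rule half_powers_le[of _ B]) (use habs in \<open>auto simp: abs_le_iff\<close>)
        then have "(1/2) ^ n0 * (\<Sum>i. (1/2) ^ Suc i * - h (i + n0) c) \<le> (1/2) ^ n0 * B"
          by (intro mult_left_mono) auto
        moreover have "(1/2) ^ n0 * (\<Sum>i. (1/2) ^ Suc i * - h (i + n0) c)
            = - (\<Sum>i. (1/2) ^ Suc (i + n0) * h (i + n0) c)"
        proof -
          have "summable (\<lambda>i. (1/2) ^ Suc i * - h (i + n0) c)"
            by (rule half_powers_summable[of _ B]) (use habs in simp)
          then have "(1/2) ^ n0 * (\<Sum>i. (1/2) ^ Suc i * - h (i + n0) c)
            = (\<Sum>i. (1/2) ^ n0 * ((1/2) ^ Suc i * - h (i + n0) c))" by (rule suminf_mult[symmetric])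
          also have "\<dots> = (\<Sum>i. - ((1/2) ^ Suc (i + n0) * h (i + n0) c))"
            by (simp add: power_add ac_simps)
          also have "\<dots> = - (\<Sum>i. (1/2) ^ Suc (i + n0) * h (i + n0) c)"
            by (rule suminf_minus) (rule summable_ignore_initial_segment[OF s])
          finally show ?thesis .
        qed
        ultimately have "- ((1/2) ^ n0 * B) \<le> (\<Sum>i. (1/2) ^ Suc (i + n0) * h (i + n0) c)" by linarith
        then have "(1 - (1/2) ^ n0) * (e / 2 - d / 2) - (1/2) ^ n0 * B \<le> ?g c"
          using 1 suminf_split_initial_segment[OF s, of n0] by linarith
        moreover have "(1 - (1/2) ^ n0) * (e / 2 - d / 2) - (1/2) ^ n0 * B
            = e / 2 - d / 2 - (1/2) ^ n0 * (e / 2 + B) + (1/2) ^ n0 * (d / 2)"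
          by (simp add: algebra_simps)
        moreover have "0 \<le> (1/2) ^ n0 * (d / 2)" using d by simp
        ultimately show ?thesis using n0 by linarith
      qed
      then show ?thesis by blast
    qed
    ultimately show ?thesis using dual_half_powers[of h] hd unfolding G_def by blast
  qed
  moreover have "\<bar>g x\<bar> \<le> B" if "g \<in> G 0" "x \<in> K" for g x
    using dual_abs[OF Gd[OF that(1)], of x] B[OF that(2)] by simp
  moreover have "\<exists>b\<in>K. (\<forall>x\<in>K. g x \<le> g b) \<and> e / 2 \<le> g b" if g: "g \<in> G 0" for g
  proof -
    obtain b where b: "b \<in> K" "\<And>x. x \<in> K \<Longrightarrow> g x \<le> g b"
      using wfip_attains_max[OF K(2) \<open>K \<noteq> {}\<close> B Gd[OF g]] by blast
    \<comment> \<open>The maximum over \<open>K\<close> also bounds \<open>g\<close> on the closed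
      hull, which contains all \<open>C m\<close>.\<close>
    have "e / 2 \<le> g b"
    proof (rule field_le_epsilon)
      fix d :: real assume "0 < d"
      then obtain m where m: "\<forall>c\<in>C m. e / 2 - d \<le> g c" using g unfolding G_def by blast
      obtain c where c: "c \<in> C m" using C(2) by blast
      then have "g c \<le> g b" using hull_le[OF Gd[OF g] b(2)] C(3) M_def by blast
      then show "e / 2 \<le> g b + d" using m c by fastforce
    qed
    then show ?thesis using b by blast
  qed
  moreover have "0 < e / 4" using e by simp
  ultimately obtain g b where g: "\<And>n. g n \<in> G n" and b: "b \<in> K"
      and gb: "\<And>n. e / 2 - e / 4 \<le> (\<Sum>i. (1/2) ^ Suc i * g (n + i) b)"
    using Simons_inequality[of G K B "e / 2" "e / 4"] by blast
  \<comment> \<open>With \<open>g n z < e / 16\<close> and \<open>z\<close> within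
    \<open>e / 16\<close> of \<open>b\<close>, the tail sums at \<open>b\<close> are at most
    \<open>e / 8\<close>, below the value \<open>e / 4\<close> from Simons' inequality.\<close>
  obtain z where z: "z \<in> Z" "nrm (z - b) < e / 16"
    using subsetD[OF Z(3) b] e unfolding cl_def by (auto dest!: spec[of _ "e / 16"])
  obtain k :: nat where k: "B / (e / 16) < real k" using reals_Archimedean2 by blast
  have "real k *\<^sub>R z \<in> Y" using z(1) by (force simp: Y_def)
  then obtain j where j: "y j = real k *\<^sub>R z"
    using range_from_nat_into[OF Y(2,1)] unfolding y_def by (metis rangeE)
  have small: "g n b \<le> e / 8" if "j \<le> n" for n
  proof -
    have "real k * g n z = g n (y j)" using j dual_scale[OF Gd[OF g]] by simp
    also have "\<dots> \<le> B" using g[of n] that by (simp add: G_def)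
    also have "\<dots> < real k * (e / 16)" using k e by (simp add: field_simps)
    finally have "g n z < e / 16" by (rule mult_left_less_imp_less) simp
    moreover have "g n b - g n z \<le> nrm (b - z)"
      using dual_abs[OF Gd[OF g], of n "b - z"] dual_diff[OF Gd[OF g]] by simp
    ultimately show ?thesis using z(2) nrm_commute[of z b] by simp
  qed
  have "(\<Sum>i. (1/2) ^ Suc i * g (j + i) b) \<le> e / 8"
    by (rule half_powers_le[of _ "nrm b"]) (use dual_abs[OF Gd[OF g]] small in auto)
  then show False using gb[of j] e by simp
qed

text \<open>Here the norm itself is the only seminorm, and the required centres are those of
  \<open>hull_asymptotic_centre\<close>.\<close>

theorem Krein_Smulian:
  assumes K: "sep K" "wfip K" and B: "\<And>x. x \<in> K \<Longrightarrow> nrm x \<le> B"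
  shows "wfip (cl (convex hull K))"
proof (rule wfip_finite_seminorms[of "{nrm}"])
  show "\<exists>k. \<forall>n. \<exists>c\<in>C n. q (c - k) \<le> e"
    if "q \<in> {nrm}" "0 < e" "nested C" "\<And>n. C n \<noteq> {} \<and> C n \<subseteq> cl (convex hull K)" for q e C
    using hull_asymptotic_centre[OF K B that(3) _ _ that(2)] that(1,4) by auto
qed (auto simp: nrm_add nrm_scale convex_cl clos_cl)

end

section \<open>A fixed point theorem for weakly sequentially continuous maps\<close>

text \<open>Brouwer's theorem of the library fixes the dimension by a type; here it has to vary inside a
  proof, so points of the cube are functions on \<open>nat\<close> of which only the values below \<open>n\<close> count.\<close>

lemma Brouwer_nat_cube_approx:
  fixes G :: "(nat \<Rightarrow> real) \<Rightarrow> nat \<Rightarrow> real"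
  assumes range: "\<And>v i. (\<forall>j<n. 0 \<le> v j \<and> v j \<le> 1) \<Longrightarrow> i < n \<Longrightarrow> 0 \<le> G v i \<and> G v i \<le> 1"
    and p: "0 < p"
  shows "\<exists>Q A B. (\<forall>j<n. 0 \<le> Q j \<and> Q j \<le> 1) \<and>
    (\<forall>i<n. (\<forall>j<n. 0 \<le> A i j \<and> A i j \<le> 1 \<and> \<bar>A i j - Q j\<bar> \<le> 1 / real p) \<and>
      (\<forall>j<n. 0 \<le> B i j \<and> B i j \<le> 1 \<and> \<bar>B i j - Q j\<bar> \<le> 1 / real p) \<and>
      A i i \<le> G (A i) i \<and> G (B i) i \<le> B i i)"
proof -
  define sc where "sc x j = real (x j) / real p" for x :: "nat \<Rightarrow> nat" and j
  \<comment> \<open>Kuhn's lemma prescribes the labels 0 and 1 on opposite faces; elsewhere the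
    label tells whether \<open>G\<close> moves coordinate \<open>i\<close> up or down. On the faces
    the same inequality holds because \<open>G\<close> stays in the cube.\<close>
  define label where "label x i = (if x i = 0 \<or> (x i \<noteq> p \<and> sc x i \<le> G (sc x) i) then 0 else 1 :: nat)"
    for x i
  obtain q where q: "\<forall>i<n. q i < p"
    and rs: "\<forall>i<n. \<exists>r s. (\<forall>j<n. q j \<le> r j \<and> r j \<le> q j + 1) \<and>
       (\<forall>j<n. q j \<le> s j \<and> s j \<le> q j + 1) \<and> label r i \<noteq> label s i"
    by (rule kuhn_lemma[OF p, of n label]) (use p in \<open>auto simp: label_def\<close>)
  have sc: "0 \<le> sc r j \<and> sc r j \<le> 1 \<and> \<bar>sc r j - sc q j\<bar> \<le> 1 / real p"
    if "\<forall>j<n. q j \<le> r j \<and> r j \<le> q j + 1" "j < n" for r j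
  proof -
    have "q j \<le> r j" "r j \<le> q j + 1" "r j \<le> p" using that q by (auto dest!: spec[of _ j])
    then have "real (r j) - real (q j) \<le> 1" "0 \<le> real (r j) - real (q j)" "real (r j) \<le> real p" by auto
    then show ?thesis using p
      by (auto simp: sc_def diff_divide_distrib[symmetric] divide_le_cancel)
  qed
  have "\<exists>a b. (\<forall>j<n. 0 \<le> a j \<and> a j \<le> 1 \<and> \<bar>a j - sc q j\<bar> \<le> 1 / real p) \<and>
      (\<forall>j<n. 0 \<le> b j \<and> b j \<le> 1 \<and> \<bar>b j - sc q j\<bar> \<le> 1 / real p) \<and> a i \<le> G a i \<and> G b i \<le> b i"
    if i: "i < n" for i
  proof -
    obtain r s where r: "\<forall>j<n. q j \<le> r j \<and> r j \<le> q j + 1" and s: "\<forall>j<n. q j \<le> s j \<and> s j \<le> q j + 1"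
      and l: "label r i \<noteq> label s i" using rs i by blast
    have zero: "sc t i \<le> G (sc t) i" if t: "\<forall>j<n. q j \<le> t j \<and> t j \<le> q j + 1" "label t i = 0" for t
      using t(2) range[of "sc t" i] sc[OF t(1)] i by (auto simp: label_def sc_def split: if_splits)
    have one: "G (sc t) i \<le> sc t i" if t: "\<forall>j<n. q j \<le> t j \<and> t j \<le> q j + 1" "label t i \<noteq> 0" for t
      using t(2) range[of "sc t" i] sc[OF t(1)] i p by (auto simp: label_def sc_def split: if_splits)
    have "label r i = 0 \<and> label s i \<noteq> 0 \<or> label r i \<noteq> 0 \<and> label s i = 0"
      using l by (auto simp: label_def split: if_splits)
    then show ?thesis
      using zero[OF r] one[OF r] zero[OF s] one[OF s] sc[OF r] sc[OF s] by blast
  qed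
  then have "\<forall>i. \<exists>a b. i < n \<longrightarrow> (\<forall>j<n. 0 \<le> a j \<and> a j \<le> 1 \<and> \<bar>a j - sc q j\<bar> \<le> 1 / real p) \<and>
      (\<forall>j<n. 0 \<le> b j \<and> b j \<le> 1 \<and> \<bar>b j - sc q j\<bar> \<le> 1 / real p) \<and> a i \<le> G a i \<and> G b i \<le> b i"
    by blast
  from choice[OF this] obtain A where "\<forall>i. \<exists>b. i < n \<longrightarrow>
      (\<forall>j<n. 0 \<le> A i j \<and> A i j \<le> 1 \<and> \<bar>A i j - sc q j\<bar> \<le> 1 / real p) \<and>
      (\<forall>j<n. 0 \<le> b j \<and> b j \<le> 1 \<and> \<bar>b j - sc q j\<bar> \<le> 1 / real p) \<and> A i i \<le> G (A i) i \<and> G b i \<le> b i"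
    by blast
  from choice[OF this] obtain B where "\<forall>i. i < n \<longrightarrow>
      (\<forall>j<n. 0 \<le> A i j \<and> A i j \<le> 1 \<and> \<bar>A i j - sc q j\<bar> \<le> 1 / real p) \<and>
      (\<forall>j<n. 0 \<le> B i j \<and> B i j \<le> 1 \<and> \<bar>B i j - sc q j\<bar> \<le> 1 / real p) \<and>
      A i i \<le> G (A i) i \<and> G (B i) i \<le> B i i"
    by blast
  moreover have "\<forall>j<n. 0 \<le> sc q j \<and> sc q j \<le> 1" using sc[of q] by auto
  ultimately show ?thesis by blast
qed

text \<open>The witnesses \<open>A m i\<close> and \<open>B m i\<close> differ from coordinate to
  coordinate, but all lie within \<open>1/(m+1)\<close> of \<open>Q m\<close>; along a subsequence
  they share the limit \<open>w\<close>, where both inequalities persist. Since \<open>w\<close> is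
  free beyond \<open>n\<close>, \<open>cont\<close> also makes \<open>G\<close> depend only on the
  values below \<open>n\<close>.\<close>

lemma Brouwer_nat_cube:
  fixes G :: "(nat \<Rightarrow> real) \<Rightarrow> nat \<Rightarrow> real"
  assumes cont: "\<And>v w i. (\<forall>k. \<forall>j<n. 0 \<le> v k j \<and> v k j \<le> 1) \<Longrightarrow> (\<forall>j<n. (\<lambda>k. v k j) \<longlonglongrightarrow> w j)
      \<Longrightarrow> i < n \<Longrightarrow> (\<lambda>k::nat. G (v k) i) \<longlonglongrightarrow> G w i"
    and range: "\<And>v i. (\<forall>j<n. 0 \<le> v j \<and> v j \<le> 1) \<Longrightarrow> i < n \<Longrightarrow> 0 \<le> G v i \<and> G v i \<le> 1"
  obtains w where "\<And>j. j < n \<Longrightarrow> 0 \<le> w j \<and> w j \<le> 1" "\<And>i. i < n \<Longrightarrow> G w i = w i"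
proof -
  have "\<forall>m. \<exists>Q A B. (\<forall>j<n. 0 \<le> Q j \<and> Q j \<le> 1) \<and>
    (\<forall>i<n. (\<forall>j<n. 0 \<le> A i j \<and> A i j \<le> 1 \<and> \<bar>A i j - Q j\<bar> \<le> 1 / real (Suc m)) \<and>
      (\<forall>j<n. 0 \<le> B i j \<and> B i j \<le> 1 \<and> \<bar>B i j - Q j\<bar> \<le> 1 / real (Suc m)) \<and>
      A i i \<le> G (A i) i \<and> G (B i) i \<le> B i i)"
    by (rule allI, rule Brouwer_nat_cube_approx, rule range) auto
  from choice[OF this] obtain Q where "\<forall>m. \<exists>A B. (\<forall>j<n. 0 \<le> Q m j \<and> Q m j \<le> 1) \<and>
    (\<forall>i<n. (\<forall>j<n. 0 \<le> A i j \<and> A i j \<le> 1 \<and> \<bar>A i j - Q m j\<bar> \<le> 1 / real (Suc m)) \<and>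
      (\<forall>j<n. 0 \<le> B i j \<and> B i j \<le> 1 \<and> \<bar>B i j - Q m j\<bar> \<le> 1 / real (Suc m)) \<and>
      A i i \<le> G (A i) i \<and> G (B i) i \<le> B i i)" by blast
  from choice[OF this] obtain A where "\<forall>m. \<exists>B. (\<forall>j<n. 0 \<le> Q m j \<and> Q m j \<le> 1) \<and>
    (\<forall>i<n. (\<forall>j<n. 0 \<le> A m i j \<and> A m i j \<le> 1 \<and> \<bar>A m i j - Q m j\<bar> \<le> 1 / real (Suc m)) \<and>
      (\<forall>j<n. 0 \<le> B i j \<and> B i j \<le> 1 \<and> \<bar>B i j - Q m j\<bar> \<le> 1 / real (Suc m)) \<and>
      A m i i \<le> G (A m i) i \<and> G (B i) i \<le> B i i)" by blast
  from choice[OF this] obtain B where QAB: "\<And>m. (\<forall>j<n. 0 \<le> Q m j \<and> Q m j \<le> 1) \<and>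
    (\<forall>i<n. (\<forall>j<n. 0 \<le> A m i j \<and> A m i j \<le> 1 \<and> \<bar>A m i j - Q m j\<bar> \<le> 1 / real (Suc m)) \<and>
      (\<forall>j<n. 0 \<le> B m i j \<and> B m i j \<le> 1 \<and> \<bar>B m i j - Q m j\<bar> \<le> 1 / real (Suc m)) \<and>
      A m i i \<le> G (A m i) i \<and> G (B m i) i \<le> B m i i)" by blast
  have "norm (Q m j) \<le> 1" if "j \<in> {..<n}" for m j using QAB[of m] that by auto
  then obtain k where k: "strict_mono k" "\<And>j. j \<in> {..<n} \<Longrightarrow> \<exists>l. (\<lambda>m. Q (k m) j) \<longlonglongrightarrow> l"
    using function_convergent_subsequence[OF countable_finite[OF finite_lessThan[of n]], of Q 1] by blast
  have "\<forall>j. \<exists>l. j < n \<longrightarrow> (\<lambda>m. Q (k m) j) \<longlonglongrightarrow> l" using k(2) by blast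
  from choice[OF this] obtain w where w: "\<And>j. j < n \<Longrightarrow> (\<lambda>m. Q (k m) j) \<longlonglongrightarrow> w j" by blast
  have inv0: "(\<lambda>m. 1 / real (Suc (k m))) \<longlonglongrightarrow> 0"
    using LIMSEQ_subseq_LIMSEQ[OF LIMSEQ_inverse_real_of_nat k(1)]
    by (simp add: o_def inverse_eq_divide)
  have near: "(\<lambda>m. D (k m) j) \<longlonglongrightarrow> w j"
    if "j < n" "\<And>m. \<bar>D m j - Q m j\<bar> \<le> 1 / real (Suc m)" for D :: "nat \<Rightarrow> nat \<Rightarrow> real" and j
  proof -
    have "(\<lambda>m. D (k m) j - Q (k m) j) \<longlonglongrightarrow> 0"
      by (rule Lim_null_comparison[OF _ inv0]) (use that(2) in \<open>simp add: always_eventually\<close>)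
    from tendsto_add[OF this w[OF that(1)]] show ?thesis by simp
  qed
  have w01: "0 \<le> w j \<and> w j \<le> 1" if "j < n" for j
    using LIMSEQ_le_const[OF w[OF that], of 0] LIMSEQ_le_const2[OF w[OF that], of 1] QAB that by auto
  have "G w i = w i" if i: "i < n" for i
  proof (rule order_antisym)
    have "(\<lambda>m. G (B (k m) i) i) \<longlonglongrightarrow> G w i"
      by (rule cont[OF _ _ i]) (use QAB i in \<open>auto intro!: near[of _ "\<lambda>m. B m i"]\<close>)
    moreover have "(\<lambda>m. B (k m) i i) \<longlonglongrightarrow> w i"
      by (rule near[of _ "\<lambda>m. B m i"]) (use QAB i in auto)
    ultimately show "G w i \<le> w i"
      by (rule LIMSEQ_le) (use QAB i in auto)
    have "(\<lambda>m. G (A (k m) i) i) \<longlonglongrightarrow> G w i"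
      by (rule cont[OF _ _ i]) (use QAB i in \<open>auto intro!: near[of _ "\<lambda>m. A m i"]\<close>)
    moreover have "(\<lambda>m. A (k m) i i) \<longlonglongrightarrow> w i"
      by (rule near[of _ "\<lambda>m. A m i"]) (use QAB i in auto)
    ultimately show "w i \<le> G w i"
      using LIMSEQ_le[of "\<lambda>m. A (k m) i i" "w i"] QAB i by blast
  qed
  then show ?thesis using that w01 by blast
qed

text \<open>Nash's map: a fixed point of
  \<open>v i \<mapsto> (v i + max 0 (F v i)) / (1 + (\<Sum>j<n. max 0 (F v j)))\<close> is a solution, and the cube
  retracts onto the simplex.\<close>

lemma simplex_equilibrium:
  fixes F :: "(nat \<Rightarrow> real) \<Rightarrow> nat \<Rightarrow> real" and n :: nat
  defines "\<Delta> \<equiv> {v. (\<forall>j<n. 0 \<le> v j) \<and> sum v {..<n} = 1}"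
  assumes n: "0 < n"
    and cont: "\<And>v w i. (\<forall>k. v k \<in> \<Delta>) \<Longrightarrow> w \<in> \<Delta> \<Longrightarrow> (\<forall>j<n. (\<lambda>k. v k j) \<longlonglongrightarrow> w j)
      \<Longrightarrow> i < n \<Longrightarrow> (\<lambda>k::nat. F (v k) i) \<longlonglongrightarrow> F w i"
    and bd: "\<And>v. v \<in> \<Delta> \<Longrightarrow> \<exists>i<n. 0 < v i \<and> F v i \<le> 0"
  obtains v where "v \<in> \<Delta>" "\<And>i. i < n \<Longrightarrow> F v i \<le> 0"
proof -
  \<comment> \<open>The retraction spreads missing mass evenly when the sum is below 1 and
    normalises when it is above 1.\<close>
  define r where "r v i = (v i + max 0 (1 - sum v {..<n}) / real n) / max 1 (sum v {..<n})"
    for v :: "nat \<Rightarrow> real" and i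
  define P where "P v = (\<Sum>j<n. max 0 (F v j))" for v
  define N where "N v i = (v i + max 0 (F v i)) / (1 + P v)" for v i
  have P0: "0 \<le> P v" for v unfolding P_def by (intro sum_nonneg) auto
  have r: "r v \<in> \<Delta>" if "\<forall>j<n. 0 \<le> v j \<and> v j \<le> 1" for v
  proof -
    have "sum (r v) {..<n} = (sum v {..<n} + max 0 (1 - sum v {..<n})) / max 1 (sum v {..<n})"
      using n by (simp add: r_def sum_divide_distrib[symmetric] sum.distrib)
    also have "\<dots> = 1" by (simp add: max_def)
    finally show ?thesis using that unfolding \<Delta>_def r_def by (auto intro!: divide_nonneg_pos add_nonneg_nonneg)
  qed
  have N: "N v \<in> \<Delta>" if "v \<in> \<Delta>" for v
  proof -
    have "sum (N v) {..<n} = (1 + P v) / (1 + P v)"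
      using that by (simp add: N_def P_def \<Delta>_def sum_divide_distrib[symmetric] sum.distrib)
    then have "sum (N v) {..<n} = 1" using P0[of v] by simp
    then show ?thesis using that P0[of v] by (auto simp: \<Delta>_def N_def)
  qed
  have le1: "v i \<le> 1" if "v \<in> \<Delta>" "i < n" for v i
    using member_le_sum[of i "{..<n}" v] that by (auto simp: \<Delta>_def)
  have rcont: "(\<lambda>k. r (v k) i) \<longlonglongrightarrow> r w i"
    if "\<forall>j<n. (\<lambda>k. v k j) \<longlonglongrightarrow> w j" "i < n" for v :: "nat \<Rightarrow> nat \<Rightarrow> real" and w i
    unfolding r_def using that n by (intro tendsto_intros) auto
  obtain w where w: "\<And>j. j < n \<Longrightarrow> 0 \<le> w j \<and> w j \<le> 1" "\<And>i. i < n \<Longrightarrow> N (r w) i = w i"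
  proof (rule Brouwer_nat_cube[of n "\<lambda>v. N (r v)"])
    fix v :: "nat \<Rightarrow> nat \<Rightarrow> real" and w i
    assume v: "\<forall>k. \<forall>j<n. 0 \<le> v k j \<and> v k j \<le> 1" "\<forall>j<n. (\<lambda>k. v k j) \<longlonglongrightarrow> w j" and i: "i < n"
    have w: "\<forall>j<n. 0 \<le> w j \<and> w j \<le> 1"
      using v LIMSEQ_le_const[of "\<lambda>k. v k j" "w j" 0 for j] LIMSEQ_le_const2[of "\<lambda>k. v k j" "w j" 1 for j]
      by blast
    have "(\<lambda>k. F (r (v k)) j) \<longlonglongrightarrow> F (r w) j" if "j < n" for j
      by (rule cont[OF _ r[OF w] _ that]) (use r v rcont in auto)
    then show "(\<lambda>k. N (r (v k)) i) \<longlonglongrightarrow> N (r w) i"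
      unfolding N_def P_def using rcont[OF v(2) i] i P0[of "r w"]
      by (intro tendsto_intros) (auto simp: P_def)
  next
    fix v :: "nat \<Rightarrow> real" and i
    assume v: "\<forall>j<n. 0 \<le> v j \<and> v j \<le> 1" and i: "i < n"
    show "0 \<le> N (r v) i \<and> N (r v) i \<le> 1"
      using N[OF r[OF v]] le1[OF N[OF r[OF v]] i] i by (auto simp: \<Delta>_def)
  qed blast
  define v where "v = r w"
  have v: "v \<in> \<Delta>" unfolding v_def using r w(1) by blast
  have "sum w {..<n} = sum (N v) {..<n}"
    using w(2) by (simp add: v_def)
  \<comment> \<open>Being a value of \<open>N\<close> below \<open>n\<close>, the fixed point lies
    on the simplex, where \<open>r\<close> changes nothing; so it is fixed by \<open>N\<close>
    itself.\<close>
  then have "sum w {..<n} = 1" using N[OF v] by (simp add: \<Delta>_def)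
  then have "v i = w i" for i by (simp add: v_def r_def)
  then have Nfix: "N v i = v i" if "i < n" for i using w(2)[OF that] by (simp add: v_def)
  have eq: "v i * P v = max 0 (F v i)" if "i < n" for i
    using Nfix[OF that] P0[of v] by (simp add: N_def field_simps)
  \<comment> \<open>An index with positive weight and no positive part forces the total
    \<open>P v\<close> to vanish, hence every positive part.\<close>
  obtain i where "i < n" "0 < v i" "F v i \<le> 0" using bd[OF v] by blast
  then have "P v = 0" using eq[of i] by simp
  then have "F v i \<le> 0" if "i < n" for i using eq[OF that] by (simp add: max_def split: if_splits)
  then show ?thesis using that v by blast
qed

context complete_norm
begin

lemma wlim_sum_abs:
  assumes "wlim u x" "\<And>j. dual (f j)"
  shows "(\<lambda>n. \<Sum>j\<in>A. \<bar>f j (u n)\<bar>) \<longlonglongrightarrow> (\<Sum>j\<in>A. \<bar>f j x\<bar>)"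
  using assms unfolding wlim_def by (intro tendsto_intros) auto

text \<open>Ky Fan's best approximation argument for the seminorm \<open>p\<close>.\<close>

lemma finite_best_approximation:
  fixes J :: nat and y :: "nat \<Rightarrow> 'a" and f :: "nat \<Rightarrow> 'a \<Rightarrow> real"
  defines "p \<equiv> \<lambda>z. \<Sum>j<J. \<bar>f j z\<bar>"
  assumes M: "convex M" and y: "\<And>i. y i \<in> M" and f: "\<And>j. dual (f j)"
    and T: "\<And>u x. (\<And>n::nat. u n \<in> M) \<Longrightarrow> x \<in> M \<Longrightarrow> wlim u x \<Longrightarrow> wlim (\<lambda>n. T (u n)) (T x)"
  shows "\<exists>x\<in>M. \<forall>i\<le>m. p (T x - x) \<le> p (T x - y i)"
proof -
  let ?n = "Suc m"
  define \<Delta> where "\<Delta> = {v::nat \<Rightarrow> real. (\<forall>j<?n. 0 \<le> v j) \<and> sum v {..<?n} = 1}"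
  define X where "X v = (\<Sum>i<?n. v i *\<^sub>R y i)" for v :: "nat \<Rightarrow> real"
  \<comment> \<open>\<open>F v i\<close> is positive exactly when \<open>y i\<close> approximates
    \<open>T (X v)\<close> strictly better than \<open>X v\<close> does.\<close>
  define F where "F v i = p (T (X v) - X v) - p (T (X v) - y i)" for v i
  have XM: "X v \<in> M" if "v \<in> \<Delta>" for v
    unfolding X_def by (rule convex_sum[OF _ M]) (use that y in \<open>auto simp: \<Delta>_def\<close>)
  have plim: "(\<lambda>k. p (u k)) \<longlonglongrightarrow> p x" if "wlim u x" for u x
    unfolding p_def using that f by (rule wlim_sum_abs)
  obtain v where v: "v \<in> \<Delta>" "\<And>i. i < ?n \<Longrightarrow> F v i \<le> 0"
  proof (rule simplex_equilibrium[of ?n F, folded \<Delta>_def])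
    fix v :: "nat \<Rightarrow> nat \<Rightarrow> real" and w i
    assume v: "\<forall>k. v k \<in> \<Delta>" and w: "w \<in> \<Delta>" and l: "\<forall>j<?n. (\<lambda>k. v k j) \<longlonglongrightarrow> w j"
    have "(\<lambda>k. \<Sum>i<?n. \<bar>v k i - w i\<bar> * nrm (y i)) \<longlonglongrightarrow> (\<Sum>i<?n. \<bar>w i - w i\<bar> * nrm (y i))"
      using l by (intro tendsto_intros) auto
    then have lim0: "(\<lambda>k. \<Sum>i<?n. \<bar>v k i - w i\<bar> * nrm (y i)) \<longlonglongrightarrow> 0" by simp
    have "nrm (X (v k) - X w) \<le> (\<Sum>i<?n. \<bar>v k i - w i\<bar> * nrm (y i))" for k
    proof -
      have "X (v k) - X w = (\<Sum>i<?n. (v k i - w i) *\<^sub>R y i)"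
        by (simp only: X_def scaleR_diff_left sum_subtractf)
      then show ?thesis
        using nrm_sum[of "{..<?n}" "\<lambda>i. (v k i - w i) *\<^sub>R y i"] by (simp only: nrm_scale finite_lessThan)
    qed
    then have "(\<lambda>k. nrm (X (v k) - X w)) \<longlonglongrightarrow> 0"
      by (intro tendsto_sandwich[OF _ _ tendsto_const lim0]) (auto intro: always_eventually)
    then have wl: "wlim (\<lambda>k. X (v k)) (X w)" by (rule wlim_of_lim)
    then have "wlim (\<lambda>k. T (X (v k))) (T (X w))" using XM v w by (intro T) auto
    moreover have "wlim (\<lambda>k. y i) (y i)" by (simp add: wlim_def)
    ultimately show "(\<lambda>k. F (v k) i) \<longlonglongrightarrow> F w i"
      unfolding F_def using wl by (intro tendsto_diff plim wlim_diff)
  next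
    fix v assume v: "v \<in> \<Delta>"
    show "\<exists>i<?n. 0 < v i \<and> F v i \<le> 0"
    proof (rule ccontr)
      \<comment> \<open>If every \<open>y i\<close> of positive weight were strictly better,
        convexity of \<open>p\<close> would make their average \<open>X v\<close> strictly better
        than itself.\<close>
      assume neg: "\<not> ?thesis"
      have v0: "0 \<le> v i" if "i < ?n" for i using v that by (auto simp: \<Delta>_def)
      have v1: "sum v {..<?n} = 1" using v by (simp add: \<Delta>_def)
      have lt: "p (T (X v) - y i) < p (T (X v) - X v)" if "i < ?n" "0 < v i" for i
        using neg that by (auto simp: F_def)
      obtain i0 where i0: "i0 < ?n" "0 < v i0"
      proof (rule ccontr)
        assume "\<not> thesis"
        then have "v i = 0" if "i < ?n" for i using v0[OF that] that \<open>\<And>i0. _ \<Longrightarrow> _ \<Longrightarrow> thesis\<close> by force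
        then have "sum v {..<?n} = 0" by simp
        then show False using v1 by simp
      qed
      have fsum: "f j (T (X v) - X v) = (\<Sum>i<?n. v i * f j (T (X v) - y i))" for j
      proof -
        have "(\<Sum>i<?n. v i * f j (T (X v) - y i)) = (\<Sum>i<?n. v i * f j (T (X v)) - v i * f j (y i))"
          by (simp only: dual_diff[OF f] right_diff_distrib)
        also have "\<dots> = sum v {..<?n} * f j (T (X v)) - (\<Sum>i<?n. v i * f j (y i))"
          by (simp only: sum_subtractf sum_distrib_right)
        also have "(\<Sum>i<?n. v i * f j (y i)) = f j (X v)"
          unfolding X_def by (simp only: linear_sum[OF dual_linear[OF f]] dual_scale[OF f])
        finally show ?thesis using v1 dual_diff[OF f] by simp
      qed
      have "p (T (X v) - X v) \<le> (\<Sum>j<J. \<Sum>i<?n. v i * \<bar>f j (T (X v) - y i)\<bar>)"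
        unfolding p_def
      proof (rule sum_mono)
        fix j
        have "\<bar>f j (T (X v) - X v)\<bar> \<le> (\<Sum>i<?n. \<bar>v i * f j (T (X v) - y i)\<bar>)"
          unfolding fsum by (rule sum_abs)
        also have "\<dots> = (\<Sum>i<?n. v i * \<bar>f j (T (X v) - y i)\<bar>)"
          by (intro sum.cong) (use v0 in \<open>auto simp: abs_mult\<close>)
        finally show "\<bar>f j (T (X v) - X v)\<bar> \<le> (\<Sum>i<?n. v i * \<bar>f j (T (X v) - y i)\<bar>)" .
      qed
      also have "\<dots> = (\<Sum>i<?n. v i * p (T (X v) - y i))"
        unfolding p_def by (subst sum.swap) (simp only: sum_distrib_left)
      also have "\<dots> < (\<Sum>i<?n. v i * p (T (X v) - X v))"
      proof (rule sum_strict_mono_ex1)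
        show "\<forall>i\<in>{..<?n}. v i * p (T (X v) - y i) \<le> v i * p (T (X v) - X v)"
        proof
          fix i assume "i \<in> {..<?n}"
          then show "v i * p (T (X v) - y i) \<le> v i * p (T (X v) - X v)"
            using v0[of i] lt[of i] by (cases "v i = 0") auto
        qed
        show "\<exists>i\<in>{..<?n}. v i * p (T (X v) - y i) < v i * p (T (X v) - X v)"
          using i0 lt[OF i0] by (intro bexI[of _ i0]) auto
      qed simp
      also have "\<dots> = p (T (X v) - X v)" using v1 by (simp only: sum_distrib_right[symmetric] mult_1)
      finally show False by simp
    qed
  qed auto
  have "\<forall>i\<le>m. p (T (X v) - X v) \<le> p (T (X v) - y i)"
    using v(2) by (auto simp: F_def less_Suc_eq_le)
  then show ?thesis using XM[OF v(1)] by blast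
qed

text \<open>Two limits are taken. For fixed \<open>J\<close> the best approximants against
  \<open>y 0, ..., y m\<close> have a weak limit \<open>x\<close> with
  \<open>p (T x - x) \<le> p (T x - y i)\<close> for all \<open>i\<close>; as \<open>T x\<close>
  lies in \<open>M\<close>, where the \<open>y i\<close> are dense, \<open>p (T x - x) = 0\<close>.
  Then \<open>J\<close> grows, and a second weak limit is fixed under all members of the separating
  family.\<close>

theorem weakly_seq_continuous_fixed_point:
  assumes M: "convex M" "sep M" "wseq M" "M \<noteq> {}" and TM: "\<And>x. x \<in> M \<Longrightarrow> T x \<in> M"
    and T: "\<And>u x. (\<And>n::nat. u n \<in> M) \<Longrightarrow> x \<in> M \<Longrightarrow> wlim u x \<Longrightarrow> wlim (\<lambda>n. T (u n)) (T x)"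
  shows "\<exists>x\<in>M. T x = x"
proof -
  obtain Z where Z: "countable Z" "Z \<subseteq> M" "M \<subseteq> cl Z" using sep_dense[OF M(2)] .
  have "Z \<noteq> {}" using Z(3) M(4) by auto
  define y where "y = from_nat_into Z"
  have yZ: "range y = Z" unfolding y_def using range_from_nat_into[OF \<open>Z \<noteq> {}\<close> Z(1)] .
  then have yM: "y i \<in> M" for i using Z(2) by blast
  obtain F where F: "countable F" "F \<noteq> {}" "\<And>f. f \<in> F \<Longrightarrow> dual f"
      "\<And>x y. x \<in> M \<Longrightarrow> y \<in> M \<Longrightarrow> (\<And>f. f \<in> F \<Longrightarrow> f x = f y) \<Longrightarrow> x = y"
    using countable_separating[OF M(2)] by metis
  define f where "f = from_nat_into F"
  have fF: "range f = F" unfolding f_def using range_from_nat_into[OF F(2,1)] .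
  then have f: "dual (f j)" for j using F(3) by blast
  have Tsub: "wlim (\<lambda>n. T (u (r n)) - u (r n)) (T x - x)"
    if "\<And>n. u n \<in> M" "x \<in> M" "wlim (u \<circ> r) x" for u x and r :: "nat \<Rightarrow> nat"
  proof (rule wlim_diff)
    show "wlim (\<lambda>n. u (r n)) x" using that(3) by (simp add: o_def)
    then show "wlim (\<lambda>n. T (u (r n))) (T x)" using that by (intro T)
  qed
  have "\<exists>x\<in>M. \<forall>j<J. f j (T x - x) = 0" for J
  proof -
    define p where "p z = (\<Sum>j<J. \<bar>f j z\<bar>)" for z
    have plim: "(\<lambda>k. p (u k)) \<longlonglongrightarrow> p x" if "wlim u x" for u x
      unfolding p_def using that f by (rule wlim_sum_abs)
    have "\<exists>x\<in>M. \<forall>i\<le>m. p (T x - x) \<le> p (T x - y i)" for m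
      unfolding p_def by (rule finite_best_approximation[OF M(1) yM f]) (rule T)
    then have "\<forall>m. \<exists>x. x \<in> M \<and> (\<forall>i\<le>m. p (T x - x) \<le> p (T x - y i))"
      by blast
    from choice[OF this] obtain u where u: "\<And>m. u m \<in> M"
        "\<And>m i. i \<le> m \<Longrightarrow> p (T (u m) - u m) \<le> p (T (u m) - y i)" by blast
    obtain x r where x: "x \<in> M" and r: "strict_mono r" "wlim (u \<circ> r) x"
      using M(3) u(1) unfolding wseq_def by blast
    have Tlim: "wlim (\<lambda>n. T (u (r n))) (T x)"
      using T[of "u \<circ> r" x] u(1) x r(2) by (simp add: o_def)
    have le: "p (T x - x) \<le> p (T x - y i)" for i
    proof (rule LIMSEQ_le[OF plim plim])
      show "wlim (\<lambda>n. T (u (r n)) - u (r n)) (T x - x)" by (rule Tsub[OF u(1) x r(2)])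
      show "wlim (\<lambda>n. T (u (r n)) - y i) (T x - y i)"
        by (rule wlim_diff[OF Tlim]) (simp add: wlim_def)
      have "p (T (u (r n)) - u (r n)) \<le> p (T (u (r n)) - y i)" if "i \<le> n" for n
        using u(2)[of i "r n"] seq_suble[OF r(1), of n] that by simp
      then show "\<exists>N. \<forall>n\<ge>N. p (T (u (r n)) - u (r n)) \<le> p (T (u (r n)) - y i)" by blast
    qed
    have "p (T x - x) \<le> 0"
    proof (rule field_le_epsilon)
      fix e :: real assume e: "0 < e"
      \<comment> \<open>\<open>p\<close> is at most \<open>J\<close> times the norm; the added 1
        covers \<open>J = 0\<close>.\<close>
      then have "0 < e / (real J + 1)" by simp
      then obtain i where "nrm (y i - T x) < e / (real J + 1)"
        using subsetD[OF Z(3) TM[OF x]] yZ unfolding cl_def by blast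
      then have i: "nrm (T x - y i) < e / (real J + 1)" by (simp add: nrm_commute)
      have "p (T x - y i) \<le> (\<Sum>j<J. nrm (T x - y i))"
        unfolding p_def by (intro sum_mono dual_abs f)
      also have "\<dots> \<le> (real J + 1) * nrm (T x - y i)" by (simp add: distrib_right)
      also have "\<dots> \<le> e" using i by (simp add: field_simps)
      finally show "p (T x - x) \<le> 0 + e" using le[of i] by simp
    qed
    moreover have "\<bar>f j (T x - x)\<bar> \<le> p (T x - x)" if "j < J" for j
      unfolding p_def using that by (intro member_le_sum) auto
    ultimately have "f j (T x - x) = 0" if "j < J" for j
      using that by (meson abs_le_zero_iff order_trans)
    then show ?thesis using x by blast
  qed
  then have "\<forall>J. \<exists>x. x \<in> M \<and> (\<forall>j<J. f j (T x - x) = 0)" by blast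
  from choice[OF this] obtain u where u: "\<And>J. u J \<in> M" "\<And>J j. j < J \<Longrightarrow> f j (T (u J) - u J) = 0"
    by blast
  obtain x r where x: "x \<in> M" and r: "strict_mono r" "wlim (u \<circ> r) x"
    using M(3) u(1) unfolding wseq_def by blast
  have "f j (T x - x) = 0" for j
  proof -
    have "(\<lambda>n. f j (T (u (r n)) - u (r n))) \<longlonglongrightarrow> f j (T x - x)"
      using Tsub[OF u(1) x r(2)] f by (simp add: wlim_def)
    moreover have "(\<lambda>n. f j (T (u (r n)) - u (r n))) \<longlonglongrightarrow> 0"
    proof (rule tendsto_eventually, rule eventually_sequentiallyI)
      fix n assume "Suc j \<le> n"
      then show "f j (T (u (r n)) - u (r n)) = 0"
        using u(2)[of j "r n"] seq_suble[OF r(1), of n] by simp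
    qed
    ultimately show ?thesis by (rule LIMSEQ_unique)
  qed
  then have "g (T x) = g x" if "g \<in> F" for g
    using that fF dual_diff[OF f] by force
  then have "T x = x" using F(4) TM x by blast
  then show ?thesis using x by blast
qed

end

section \<open>Generalized Banach spaces\<close>

abbreviation max_norm :: "('a::real_vector \<Rightarrow> real^'n) \<Rightarrow> 'a \<Rightarrow> real" where
  "max_norm N x \<equiv> gen_dist N x 0"

lemma gen_dist_max_norm: "gen_dist N x y = max_norm N (x - y)"
  by (simp add: gen_dist_def)

lemma max_norm_component: "N x $ i \<le> max_norm N x"
  by (simp add: gen_dist_def)

lemma gen_norm_component:
  assumes "gen_norm N"
  shows "0 \<le> N x $ i" "N (x + y) $ i \<le> N x $ i + N y $ i" "N (c *\<^sub>R x) $ i = \<bar>c\<bar> * N x $ i"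
  using assms by (auto simp: gen_norm_def less_eq_vec_def)

lemma gen_norm_uminus:
  assumes "gen_norm N"
  shows "N (- x) = N x"
  using assms[unfolded gen_norm_def, THEN conjunct2, THEN conjunct2, THEN conjunct1, rule_format, of "- 1" x]
  by simp

lemma complete_norm_max_norm:
  assumes "gen_banach N"
  shows "complete_norm (max_norm N)"
proof
  have N: "gen_norm N" using assms by (simp add: gen_banach_def)
  interpret Metric_space UNIV "gen_dist N" by (rule Metric_space_gen_dist[OF N])
  note comp = gen_norm_component[OF N]
  show "max_norm N (x + y) \<le> max_norm N x + max_norm N y" for x y
    unfolding gen_dist_le_iff
    using comp(2)[of x y] max_norm_component[of N x] max_norm_component[of N y]
    by (smt (verit) diff_zero)
  have le: "max_norm N (c *\<^sub>R x) \<le> \<bar>c\<bar> * max_norm N x" for c x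
    unfolding gen_dist_le_iff
    using max_norm_component[of N x] by (simp add: comp(3) mult_left_mono)
  show "max_norm N (c *\<^sub>R x) = \<bar>c\<bar> * max_norm N x" for c x
  proof (cases "c = 0")
    case False
    have "max_norm N (inverse c *\<^sub>R (c *\<^sub>R x)) \<le> \<bar>inverse c\<bar> * max_norm N (c *\<^sub>R x)" by (rule le)
    then have "\<bar>c\<bar> * max_norm N x \<le> max_norm N (c *\<^sub>R x)"
      using False by (simp add: field_simps)
    then show ?thesis using le[of c x] by simp
  qed simp
  show "x = 0" if "max_norm N x = 0" for x
    using that by simp
  show "\<exists>x. (\<lambda>n. max_norm N (u n - x)) \<longlonglongrightarrow> 0"
    if "\<And>e. 0 < e \<Longrightarrow> \<exists>k. \<forall>m\<ge>k. \<forall>n\<ge>k. max_norm N (u m - u n) < e" for u :: "nat \<Rightarrow> 'a"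
  proof -
    have "MCauchy u" using that unfolding MCauchy_def by (simp add: gen_dist_max_norm[of N "u _"])
    then obtain x where "limitin mtopology u x sequentially"
      using assms unfolding gen_banach_def mcomplete_def by blast
    then have "(\<lambda>n. gen_dist N (u n) x) \<longlonglongrightarrow> 0" by (simp add: limitin_metric_dist_null)
    then show ?thesis by (subst (asm) gen_dist_max_norm) blast
  qed
qed

locale gen_banach_space =
  fixes N :: "'a::real_vector \<Rightarrow> real^'n"
  assumes gen_banach: "gen_banach N"

sublocale gen_banach_space \<subseteq> complete_norm "max_norm N"
  by (rule complete_norm_max_norm[OF gen_banach])

context gen_banach_space
begin

lemma gen_norm: "gen_norm N"
  using gen_banach by (simp add: gen_banach_def)

lemmas component = gen_norm_component[OF gen_norm]

sublocale metric: Metric_space UNIV "gen_dist N"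
  by (rule Metric_space_gen_dist[OF gen_norm])

section \<open>Norm and weak topology expressed by closures and functionals\<close>

lemma closedin_gen_topology_iff: "closedin (gen_topology N) A \<longleftrightarrow> clos A"
proof
  assume A: "closedin (gen_topology N) A"
  show "clos A"
    unfolding clos_def
  proof (rule subsetI, rule ccontr)
    fix x assume x: "x \<in> cl A" "x \<notin> A"
    then obtain r where r: "0 < r" "disjnt A (metric.mball x r)"
      using A unfolding gen_topology_def metric.closedin_metric by blast
    then obtain a where a: "a \<in> A" "max_norm N (a - x) < r" using x unfolding cl_def by blast
    then have "a \<in> metric.mball x r"
      by (simp add: metric.commute[of x a] gen_dist_max_norm[of N a x])
    then show False using a r by (auto simp: disjnt_def)
  qed
next
  assume A: "clos A"
  show "closedin (gen_topology N) A"
    unfolding gen_topology_def metric.closedin_metric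
  proof (intro conjI allI impI)
    fix x assume "x \<in> UNIV - A"
    then obtain r where r: "0 < r" "\<forall>a\<in>A. r \<le> max_norm N (a - x)"
      using closD[OF A, of x] by (meson DiffD2 not_less)
    have "disjnt A (metric.mball x r)"
      unfolding disjnt_iff
    proof (intro allI notI, elim conjE)
      fix a assume "a \<in> A" "a \<in> metric.mball x r"
      then show False
        using r(2) metric.commute[of x a] gen_dist_max_norm[of N a x] by fastforce
    qed
    then show "\<exists>r>0. disjnt A (metric.mball x r)" using r(1) by blast
  qed simp
qed

lemma openin_gen_topology_iff:
  "openin (gen_topology N) U \<longleftrightarrow> (\<forall>x\<in>U. \<exists>r>0. \<forall>y. max_norm N (y - x) < r \<longrightarrow> y \<in> U)"
proof -
  have "metric.mball x r = {y. max_norm N (y - x) < r}" for x r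
    by (auto simp: metric.commute[of x] gen_dist_max_norm[of N _ x])
  then show ?thesis unfolding gen_topology_def metric.openin_mtopology by (simp add: subset_iff Ball_def)
qed

lemma topspace_gen_topology [simp]: "topspace (gen_topology N) = UNIV"
  by (simp add: gen_topology_def)

lemma continuous_dual:
  assumes "dual f"
  shows "continuous_map (gen_topology N) euclideanreal f"
  unfolding continuous_map_def openin_gen_topology_iff
proof (intro conjI allI impI ballI)
  fix U x assume U: "openin euclideanreal U" and x: "x \<in> {x \<in> topspace (gen_topology N). f x \<in> U}"
  then obtain e where e: "0 < e" "\<And>t. dist t (f x) < e \<Longrightarrow> t \<in> U" by (auto simp: open_dist)
  have "f y \<in> U" if "max_norm N (y - x) < e" for y
    using e(2) that dual_abs[OF assms, of "y - x"] by (simp add: dist_real_def dual_diff[OF assms])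
  then show "\<exists>r>0. \<forall>y. max_norm N (y - x) < r \<longrightarrow> y \<in> {x \<in> topspace (gen_topology N). f x \<in> U}"
    using e(1) by auto
qed simp

text \<open>Continuity at 0 gives a ball of radius \<open>r\<close> on which \<open>f\<close> is
  below 1 in absolute value; the factor \<open>r / 2\<close> keeps the rescaled test point strictly
  inside it.\<close>

lemma continuous_functional_multiple_of_dual:
  assumes f: "linear f" "continuous_map (gen_topology N) euclideanreal f"
  obtains c where "0 < c" "dual (\<lambda>x. c * f x)"
proof -
  have "openin (gen_topology N) {x. f x \<in> {-1<..<1}}"
    using openin_continuous_map_preimage[OF f(2), of "{-1<..<1}"] by simp
  moreover have "0 \<in> {x. f x \<in> {-1<..<1}}" using linear_0[OF f(1)] by simp
  ultimately obtain r where "0 < r" "\<forall>y. max_norm N (y - 0) < r \<longrightarrow> y \<in> {x. f x \<in> {-1<..<1}}"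
    unfolding openin_gen_topology_iff by blast
  then have r: "0 < r" "\<And>x. max_norm N x < r \<Longrightarrow> \<bar>f x\<bar> < 1" by (auto simp: abs_less_iff)
  have "r / 2 * f x \<le> max_norm N x" for x
  proof (cases "x = 0")
    case True
    then show ?thesis using linear_0[OF f(1)] by simp
  next
    case False
    define n where "n = max_norm N x"
    have n: "0 < n" using False nrm_pos[of x 0] by (simp add: n_def)
    have "max_norm N ((r / (2 * n)) *\<^sub>R x) = r / 2" using n r(1) by (simp add: nrm_scale n_def[symmetric])
    then have "\<bar>f ((r / (2 * n)) *\<^sub>R x)\<bar> < 1" using r by simp
    then have "f ((r / (2 * n)) *\<^sub>R x) < 1" by linarith
    then have "r / (2 * n) * f x < 1" by (simp add: linear_cmul[OF f(1)])
    then show ?thesis using n by (simp add: n_def[symmetric] field_simps)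
  qed
  moreover have "linear (\<lambda>x. r / 2 * f x)"
    using linear_compose_scale_right[OF f(1), of "r / 2"] by simp
  ultimately have "dual (\<lambda>x. r / 2 * f x)" by (simp add: dual_def)
  then show ?thesis using that[of "r / 2"] r(1) by simp
qed

lemma limitin_weak_topology_iff:
  "limitin (weak_topology N) u x sequentially \<longleftrightarrow> wlim u x"
proof
  assume l: "limitin (weak_topology N) u x sequentially"
  show "wlim u x"
    unfolding wlim_def
  proof (intro allI impI)
    fix f assume f: "dual f"
    have "continuous_map (weak_topology N) euclideanreal f"
      by (rule continuous_map_weak_topology[OF dual_linear[OF f] continuous_dual[OF f]])
    from continuous_map_limit[OF this l] show "(\<lambda>n. f (u n)) \<longlonglongrightarrow> f x" by (simp add: o_def)
  qed
next
  assume w: "wlim u x"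
  show "limitin (weak_topology N) u x sequentially"
    unfolding limitin_def
  proof (intro conjI allI impI, simp, elim conjE)
    fix U assume "openin (weak_topology N) U" "x \<in> U"
    then have "generate_topology_on {f -` U | (f :: 'a \<Rightarrow> real) U.
          linear f \<and> continuous_map (gen_topology N) euclideanreal f \<and> open U} U" "x \<in> U"
      unfolding weak_topology_def by (auto dest: openin_topology_generated_by)
    then show "\<forall>\<^sub>F n in sequentially. u n \<in> U"
    proof (induction rule: generate_topology_on.induct)
      case (Int a b)
      then show ?case by (auto simp: eventually_conj_iff)
    next
      case (UN K)
      then obtain k where "k \<in> K" "x \<in> k" by blast
      then have "\<forall>\<^sub>F n in sequentially. u n \<in> k" using UN by blast
      then show ?case by (rule eventually_mono) (use \<open>k \<in> K\<close> in blast)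
    next
      case (Basis s)
      then obtain f and W :: "real set" where s: "s = f -` W" "linear f"
          "continuous_map (gen_topology N) euclideanreal f" "open W" by blast
      obtain c where c: "0 < c" "dual (\<lambda>x. c * f x)"
        using continuous_functional_multiple_of_dual[OF s(2,3)] .
      have "(\<lambda>n. c * f (u n)) \<longlonglongrightarrow> c * f x" using w c(2) unfolding wlim_def by blast
      from tendsto_mult_left[OF this, of "inverse c"]
      have "(\<lambda>n. f (u n)) \<longlonglongrightarrow> f x" using c(1) by simp
      then show ?case using topological_tendstoD[OF _ s(4)] Basis(2) s(1) by auto
    qed simp
  qed
qed

lemma closedin_weak_topology:
  assumes "convex A" "clos A"
  shows "closedin (weak_topology N) A"
  unfolding closedin_def
proof (intro conjI)
  show "openin (weak_topology N) (topspace (weak_topology N) - A)"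
    unfolding topspace_weak_topology
  proof (subst openin_subopen, intro ballI)
    fix x assume x: "x \<in> UNIV - A"
    then obtain f e where f: "dual f" "0 < e" "\<And>h. h \<in> A \<Longrightarrow> f x + e \<le> f h"
      using Mazur_separation[OF assms] by blast
    have "continuous_map (weak_topology N) euclideanreal f"
      by (rule continuous_map_weak_topology[OF dual_linear[OF f(1)] continuous_dual[OF f(1)]])
    from openin_continuous_map_preimage[OF this, of "{..<f x + e}"]
    have "openin (weak_topology N) {y. f y < f x + e}" by simp
    moreover have "x \<in> {y. f y < f x + e}" "{y. f y < f x + e} \<subseteq> UNIV - A"
      using f by (auto simp: not_less[symmetric])
    ultimately show "\<exists>T. openin (weak_topology N) T \<and> x \<in> T \<and> T \<subseteq> UNIV - A" by blast
  qed
qed simp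

lemma compactin_imp_wfip:
  assumes K: "compactin (weak_topology N) K"
  shows "wfip K"
  unfolding wfip_def
proof (intro allI impI)
  fix H assume H: "nested H" "\<forall>n. K \<inter> H n \<noteq> {}"
  have "K \<inter> \<Inter>(range H) \<noteq> {}"
  proof (rule compactin_fip[THEN iffD1, OF K, THEN conjunct2, rule_format], intro conjI ballI allI impI)
    fix C assume "C \<in> range H"
    then show "closedin (weak_topology N) C"
      using H(1) by (auto simp: nested_def intro!: closedin_weak_topology)
  next
    fix F assume "finite F \<and> F \<subseteq> range H"
    then obtain I where I: "finite I" "F = H ` I" by (meson finite_subset_image)
    have "H (Max I) \<subseteq> H i" if "i \<in> I" for i
      using nested_antimono[OF H(1)] I(1) that by auto
    then have "K \<inter> H (Max I) \<subseteq> K \<inter> \<Inter>F" using I(2) by blast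
    then show "K \<inter> \<Inter>F \<noteq> {}" using H(2) by blast
  qed
  then show "\<exists>x\<in>K. \<forall>n. x \<in> H n" by blast
qed

text \<open>A separable set is Lindelof in the norm topology, hence in the weak one.\<close>

lemma wseq_imp_compactin:
  assumes K: "sep K" "wseq K"
  shows "compactin (weak_topology N) K"
  unfolding compactin_def
proof (intro conjI allI impI, simp, elim conjE)
  fix \<U> assume \<U>: "\<forall>U\<in>\<U>. openin (weak_topology N) U" "K \<subseteq> \<Union>\<U>"
  obtain Z where Z: "countable Z" "Z \<subseteq> K" "K \<subseteq> cl Z" using sep_dense[OF K(1)] .
  \<comment> \<open>Each ball of radius \<open>1/(n+1)\<close> about a dense point that fits into
    some member of the cover selects one such member; \<open>V\<close> collects them.\<close>
  define P where "P = (\<lambda>(z, n::nat) U. U \<in> \<U> \<and> (\<forall>y. max_norm N (y - z) < inverse (real (Suc n)) \<longrightarrow> y \<in> U))"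
  define V where "V = (\<lambda>p. SOME U. P p U) ` {p \<in> Z \<times> UNIV. \<exists>U. P p U}"
  have "countable V"
    unfolding V_def by (intro countable_image countable_subset[OF Collect_subset] countable_SIGMA Z) auto
  have VP: "\<exists>p. P p U" if "U \<in> V" for U
    using that someI_ex[of "P p" for p] unfolding V_def by blast
  then have V: "V \<subseteq> \<U>" by (auto simp: P_def)
  have cover: "K \<subseteq> \<Union>V"
  proof
    fix x assume x: "x \<in> K"
    then obtain U where U: "U \<in> \<U>" "x \<in> U" using \<U>(2) by blast
    have "openin (gen_topology N) U"
      by (rule weak_topology_coarsest[OF topspace_gen_topology _ bspec[OF \<U>(1) U(1)]])
    then obtain r where r: "0 < r" "\<And>y. max_norm N (y - x) < r \<Longrightarrow> y \<in> U"
      using U(2) unfolding openin_gen_topology_iff by blast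
    then obtain n where n: "inverse (real (Suc n)) < r / 2" using reals_Archimedean[of "r / 2"] by auto
    have "0 < inverse (real (Suc n))" by simp
    then obtain z where z: "z \<in> Z" "max_norm N (z - x) < inverse (real (Suc n))"
      using x Z(3) unfolding cl_def by blast
    have "y \<in> U" if "max_norm N (y - z) < inverse (real (Suc n))" for y
      by (rule r(2)) (use that z(2) n nrm_triangle[of y x z] in linarith)
    then have ex: "\<exists>U. P (z, n) U" using U(1) by (auto simp: P_def)
    define W where "W = (SOME U. P (z, n) U)"
    have "P (z, n) W" unfolding W_def by (rule someI_ex[OF ex])
    then have "x \<in> W" using z(2) nrm_commute[of z x] by (simp add: P_def)
    moreover have "W \<in> V" unfolding V_def W_def using ex z(1) by (intro image_eqI[of _ _ "(z, n)"]) auto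
    ultimately show "x \<in> \<Union>V" by blast
  qed
  show "\<exists>\<F>. finite \<F> \<and> \<F> \<subseteq> \<U> \<and> K \<subseteq> \<Union>\<F>"
  proof (cases "K = {}")
    case False
    then have "V \<noteq> {}" using cover by blast
    define v where "v = from_nat_into V"
    have v: "range v = V"
      unfolding v_def by (rule range_from_nat_into[OF \<open>V \<noteq> {}\<close> \<open>countable V\<close>])
    show ?thesis
    proof (rule ccontr)
      assume neg: "\<not> ?thesis"
      \<comment> \<open>Without a finite subcover some \<open>u n\<close> avoids the first
        \<open>n + 1\<close> members; a weak limit of a subsequence lies in some \<open>v j\<close>,
        which the subsequence would then have to enter.\<close>
      have "\<forall>n. \<exists>x. x \<in> K \<and> x \<notin> \<Union>(v ` {..n})"
      proof (rule allI, rule ccontr)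
        fix n assume "\<not> (\<exists>x. x \<in> K \<and> x \<notin> \<Union>(v ` {..n}))"
        then have "K \<subseteq> \<Union>(v ` {..n})" by blast
        moreover have "v ` {..n} \<subseteq> \<U>" using v V by blast
        ultimately show False using neg by blast
      qed
      from choice[OF this] obtain u where u: "\<And>n. u n \<in> K" "\<And>n. u n \<notin> \<Union>(v ` {..n})" by blast
      obtain x r where x: "x \<in> K" "strict_mono r" "wlim (u \<circ> r) x"
        using K(2) u(1) unfolding wseq_def by blast
      then obtain j where j: "x \<in> v j" using cover v by blast
      have "openin (weak_topology N) (v j)" using \<U>(1) v V by blast
      then have "\<forall>\<^sub>F n in sequentially. (u \<circ> r) n \<in> v j"
        using x(3) j unfolding limitin_weak_topology_iff[symmetric] limitin_def by blast
      then obtain n0 where n0: "\<And>n. n0 \<le> n \<Longrightarrow> u (r n) \<in> v j" by (auto simp: eventually_sequentially)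
      let ?n = "max n0 j"
      have "j \<le> r ?n" using seq_suble[OF x(2), of ?n] by simp
      then show False using n0[of ?n] u(2)[of "r ?n"] by auto
    qed
  qed (auto intro: exI[of _ "{}"])
qed

section \<open>The measure of weak noncompactness\<close>

definition weak_radii :: "'a set \<Rightarrow> (real^'n) set" where
  "weak_radii V = {r. 0 \<le> r \<and> (\<exists>K. compactin (weak_topology N) K \<and> V \<subseteq> K + gen_cball N r)}"

lemma weak_noncompactness_component:
  "weak_noncompactness N V $ i = (INF r\<in>weak_radii V. r $ i)"
  by (simp add: weak_noncompactness_def weak_radii_def Inf_vec_def)

lemma bdd_below_weak_radii: "bdd_below ((\<lambda>r. r $ i) ` weak_radii V)"
  by (rule bdd_belowI[of _ 0]) (auto simp: weak_radii_def less_eq_vec_def)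

text \<open>Comparing measures by inclusion of radii treats all components at once; nonemptiness
  keeps the smaller infimum set meaningful.\<close>

lemma weak_noncompactness_mono:
  assumes "weak_radii A \<subseteq> weak_radii B" "weak_radii A \<noteq> {}"
  shows "weak_noncompactness N B \<le> weak_noncompactness N A"
  unfolding less_eq_vec_def weak_noncompactness_component
  using assms by (auto intro!: cINF_superset_mono bdd_below_weak_radii)

lemma weak_noncompactness_nonneg:
  assumes "weak_radii V \<noteq> {}"
  shows "0 \<le> weak_noncompactness N V"
  unfolding less_eq_vec_def weak_noncompactness_component
  using assms by (auto intro!: cINF_greatest simp: weak_radii_def less_eq_vec_def)

lemma bounded_imp_max_norm_le:
  assumes "gen_bounded N V"
  obtains B where "\<And>x. x \<in> V \<Longrightarrow> max_norm N x \<le> B"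
proof -
  obtain r where r: "\<forall>x\<in>V. N x \<le> r" using assms unfolding gen_bounded_iff[OF gen_norm] by blast
  have "max_norm N x \<le> Max (range (\<lambda>i. r $ i))" if "x \<in> V" for x
    unfolding gen_dist_le_iff
  proof
    fix i
    have "N x $ i \<le> r $ i" using r that by (simp add: less_eq_vec_def)
    also have "\<dots> \<le> Max (range (\<lambda>i. r $ i))" by simp
    finally show "N (x - 0) $ i \<le> Max (range (\<lambda>i. r $ i))" by simp
  qed
  then show ?thesis using that by blast
qed

lemma bounded_imp_weak_radii:
  assumes "gen_bounded N V"
  shows "weak_radii V \<noteq> {}"
proof -
  obtain B where B: "\<And>x. x \<in> V \<Longrightarrow> max_norm N x \<le> B"
    using bounded_imp_max_norm_le[OF assms] by blast
  define r :: "real^'n" where "r = (\<chi> i. \<bar>B\<bar>)"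
  have "V \<subseteq> {0} + gen_cball N r"
  proof
    fix x assume "x \<in> V"
    then have "N x \<le> r" using B[of x] by (auto simp: less_eq_vec_def r_def gen_dist_le_iff intro: order_trans)
    then show "x \<in> {0} + gen_cball N r" by (auto simp: gen_cball_def set_plus_def)
  qed
  moreover have "0 \<le> r" by (simp add: r_def less_eq_vec_def)
  moreover have "compactin (weak_topology N) {0}" by simp
  ultimately have "r \<in> weak_radii V" unfolding weak_radii_def by blast
  then show ?thesis by blast
qed

lemma gen_cball_Inter: "gen_cball N r = \<Inter>(range (\<lambda>i. {x. N (x - 0) $ i \<le> r $ i}))"
  by (auto simp: gen_cball_def less_eq_vec_def)

lemma clos_gen_cball: "clos (gen_cball N r)"
  unfolding gen_cball_Inter
  by (rule clos_Inter) (auto intro!: clos_seminorm_le[of "\<lambda>x. N x $ i" 0 for i, simplified] component max_norm_component)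

lemma convex_gen_cball: "convex (gen_cball N r)"
  unfolding gen_cball_Inter
  by (rule convex_Inter) (auto intro!: convex_seminorm_le[of "\<lambda>x. N x $ i" 0 for i, simplified] component)

text \<open>Along a subsequence the summands from \<open>K\<close> converge weakly, so the remaining
  summands do too, and the closed convex set \<open>B\<close> contains their weak limit.\<close>

lemma clos_wseq_plus:
  assumes K: "wseq K" and B: "convex B" "clos B"
  shows "clos (K + B)"
  unfolding clos_def
proof
  fix x assume x: "x \<in> cl (K + B)"
  obtain w where w: "\<And>n::nat. w n \<in> K + B" "(\<lambda>n. max_norm N (w n - x)) \<longlonglongrightarrow> 0"
    using cl_seq[OF x] by blast
  have "\<forall>n. \<exists>k. k \<in> K \<and> w n - k \<in> B"
    using w(1) by (metis add_diff_cancel_left' set_plus_elim)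
  from choice[OF this] obtain k where k: "\<And>n. k n \<in> K" "\<And>n. w n - k n \<in> B" by blast
  obtain y r where y: "y \<in> K" "strict_mono r" "wlim (k \<circ> r) y"
    using K k(1) unfolding wseq_def by blast
  have "wlim (\<lambda>n. (w \<circ> r) n - (k \<circ> r) n) (x - y)"
    by (rule wlim_diff[OF wlim_subseq[OF wlim_of_lim[OF w(2)] y(2)] y(3)])
  then have "x - y \<in> B" by (rule wlim_clos_convex[OF _ _ B]) (use k(2) in simp)
  then show "x \<in> K + B" using y(1) set_plus_intro[of y K "x - y" B] by simp
qed

lemma wfip_Int: "wfip K \<Longrightarrow> convex A \<Longrightarrow> clos A \<Longrightarrow> wfip (K \<inter> A)"
  unfolding wfip_def
proof (intro allI impI)
  fix H assume K: "\<forall>H. nested H \<longrightarrow> (\<forall>n. K \<inter> H n \<noteq> {}) \<longrightarrow> (\<exists>x\<in>K. \<forall>n. x \<in> H n)"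
    and A: "convex A" "clos A" and H: "nested H" "\<forall>n. K \<inter> A \<inter> H n \<noteq> {}"
  have "\<exists>x\<in>K. \<forall>n. x \<in> H n \<inter> A"
    using K[rule_format, of "\<lambda>n. H n \<inter> A"] nested_Int[OF H(1) A] H(2) by (simp add: Int_ac)
  then show "\<exists>x\<in>K \<inter> A. \<forall>n. x \<in> H n" by blast
qed

lemma max_norm_le_cl_convex_hull:
  assumes "\<And>x. x \<in> A \<Longrightarrow> max_norm N x \<le> B" "x \<in> cl (convex hull A)"
  shows "max_norm N x \<le> B"
proof -
  have "cl (convex hull A) \<subseteq> {x. max_norm N (x - 0) \<le> B}"
    using assms(1) by (intro cl_minimal hull_minimal clos_seminorm_le convex_seminorm_le nrm_add nrm_scale) auto
  then show ?thesis using assms(2) by auto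
qed

text \<open>The same radius works with a larger compact set: \<open>K\<close> is replaced by a
  weakly compact convex \<open>K'\<close>, and then \<open>K' + gen_cball N r\<close> is closed and
  convex, so that it absorbs the closed hull as soon as it contains \<open>x0\<close> and a dense
  part of \<open>V\<close>.\<close>

theorem weak_radii_closed_convex_hull:
  assumes V: "sep V" "gen_bounded N V"
  shows "weak_radii V \<subseteq> weak_radii (cl (convex hull (insert x0 V)))"
proof
  fix r assume "r \<in> weak_radii V"
  then obtain K where r: "0 \<le> r" and K: "compactin (weak_topology N) K" "V \<subseteq> K + gen_cball N r"
    unfolding weak_radii_def by blast
  obtain V1 where V1: "countable V1" "V1 \<subseteq> V" "V \<subseteq> cl V1" using sep_dense[OF V(1)] .
  have "\<forall>v. \<exists>k. v \<in> V \<longrightarrow> k \<in> K \<and> v - k \<in> gen_cball N r"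
    using K(2) by (metis add_diff_cancel_left' set_plus_elim subsetD)
  from choice[OF this] obtain \<kappa> where \<kappa>: "\<And>v. v \<in> V \<Longrightarrow> \<kappa> v \<in> K" "\<And>v. v \<in> V \<Longrightarrow> v - \<kappa> v \<in> gen_cball N r"
    by blast
  define K1 where "K1 = insert x0 (\<kappa> ` V1)"
  \<comment> \<open>\<open>K\<close> itself may be nonseparable. Intersecting with the closed hull
    of countably many chosen points makes it separable and retains those points.\<close>
  define K2 where "K2 = insert x0 K \<inter> cl (convex hull K1)"
  define K' where "K' = cl (convex hull K2)"
  have "countable K1" using V1(1) by (simp add: K1_def)
  then have "sep K1" using subset_cl[of K1] unfolding sep_def by blast
  then have "sep K2" unfolding K2_def by (rule sep_subset[OF sep_cl_convex_hull Int_lower2])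
  then have sep: "sep K'" unfolding K'_def by (rule sep_cl_convex_hull)
  have "compactin (weak_topology N) (insert x0 K)"
    using compactin_Un[of "weak_topology N" "{x0}" K] K(1) by simp
  then have "wfip K2"
    unfolding K2_def by (intro wfip_Int compactin_imp_wfip convex_cl convex_convex_hull clos_cl)
  obtain B where B: "\<And>x. x \<in> V \<Longrightarrow> max_norm N x \<le> B"
    using bounded_imp_max_norm_le[OF V(2)] by blast
  \<comment> \<open>Each chosen point \<open>\<kappa> v\<close> differs from \<open>v\<close> by at
    most \<open>r\<close>, which bounds \<open>K1\<close>, hence \<open>K2\<close> and
    \<open>K'\<close>.\<close>
  define C where "C = max (max_norm N x0) (B + Max (range (\<lambda>i. r $ i)))"
  have "max_norm N x \<le> C" if x: "x \<in> K1" for x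
  proof (cases "x = x0")
    case False
    then obtain v where v: "v \<in> V" "x = \<kappa> v" using x V1(2) by (auto simp: K1_def)
    have "max_norm N (v - \<kappa> v) \<le> Max (range (\<lambda>i. r $ i))"
      unfolding gen_dist_le_iff
    proof
      fix i
      have "N (v - \<kappa> v) $ i \<le> r $ i" using \<kappa>(2)[OF v(1)] by (simp add: gen_cball_def less_eq_vec_def)
      also have "\<dots> \<le> Max (range (\<lambda>i. r $ i))" by simp
      finally show "N (v - \<kappa> v - 0) $ i \<le> Max (range (\<lambda>i. r $ i))" by simp
    qed
    then show ?thesis
      using B[OF v(1)] nrm_triangle[of "\<kappa> v" 0 v] nrm_commute[of v "\<kappa> v"] v(2) by (simp add: C_def)
  qed (simp add: C_def)
  then have CK2: "max_norm N x \<le> C" if "x \<in> K2" for x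
    using that max_norm_le_cl_convex_hull[of K1 C x] by (simp add: K2_def)
  have "wfip K'" unfolding K'_def by (rule Krein_Smulian[OF \<open>sep K2\<close> \<open>wfip K2\<close> CK2])
  then have wseq: "wseq K'"
    by (rule wfip_imp_wseq[OF sep, of C]) (use max_norm_le_cl_convex_hull[OF CK2] K'_def in blast)
  let ?W = "K' + gen_cball N r"
  have W: "convex ?W" "clos ?W"
    using wseq by (auto simp: K'_def intro!: convex_set_plus convex_cl convex_gen_cball clos_wseq_plus clos_gen_cball)
  have "K1 \<subseteq> K2"
    using subset_cl[of "convex hull K1"] hull_subset[of K1 convex] \<kappa>(1) V1(2)
    unfolding K2_def by (auto simp: K1_def)
  then have K1: "K1 \<subseteq> K'"
    using subset_cl[of "convex hull K2"] hull_subset[of K2 convex] unfolding K'_def by blast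
  have "N 0 = 0" using gen_norm by (simp add: gen_norm_def)
  then have "0 \<in> gen_cball N r" using r by (simp add: gen_cball_def)
  then have x0: "x0 \<in> ?W" using K1 set_plus_intro[of x0 K' 0] by (auto simp: K1_def)
  have "V1 \<subseteq> ?W"
  proof
    fix v assume "v \<in> V1"
    then have "\<kappa> v \<in> K'" "v - \<kappa> v \<in> gen_cball N r" using K1 \<kappa>(2) V1(2) by (auto simp: K1_def)
    then have "\<kappa> v + (v - \<kappa> v) \<in> ?W" by (rule set_plus_intro)
    then show "v \<in> ?W" by simp
  qed
  then have "V \<subseteq> ?W" using cl_minimal[OF _ W(2)] V1(3) by blast
  then have "cl (convex hull (insert x0 V)) \<subseteq> ?W"
    using x0 W by (intro cl_minimal hull_minimal) auto
  moreover have "compactin (weak_topology N) K'" by (rule wseq_imp_compactin[OF sep wseq])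
  ultimately show "r \<in> weak_radii (cl (convex hull (insert x0 V)))"
    using r unfolding weak_radii_def by blast
qed

text \<open>The infimum is componentwise, so no single \<open>r\<close> need be small in all components: each one
  has to be treated with a weakly compact set of its own.\<close>

theorem weak_noncompactness_zero_imp_wfip:
  assumes M: "convex M" "clos M" and rad: "weak_radii M \<noteq> {}" and zero: "weak_noncompactness N M = 0"
  shows "wfip M"
proof (rule wfip_finite_seminorms[of "range (\<lambda>i x. N x $ i)"])
  show "finite (range (\<lambda>i x. N x $ i))" by simp
  show "\<exists>q\<in>range (\<lambda>i x. N x $ i). max_norm N x \<le> q x" for x
  proof -
    have "Max (range (\<lambda>i. N (x - 0) $ i)) \<in> range (\<lambda>i. N (x - 0) $ i)" by (intro Max_in) auto
    then obtain i where "Max (range (\<lambda>i. N (x - 0) $ i)) = N (x - 0) $ i" by blast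
    then have "max_norm N x = N x $ i" unfolding gen_dist_def by (simp only: diff_zero)
    then show ?thesis by (intro bexI[of _ "\<lambda>x. N x $ i"]) auto
  qed
  fix q :: "'a \<Rightarrow> real" and e :: real and C
  assume "q \<in> range (\<lambda>i x. N x $ i)" and e: "0 < e" and C: "nested C" "\<And>n. C n \<noteq> {} \<and> C n \<subseteq> M"
  then obtain i where q: "q = (\<lambda>x. N x $ i)" by blast
  have "(INF r\<in>weak_radii M. r $ i) < e / 2"
    using zero e weak_noncompactness_component[of M i] by simp
  then obtain r where r: "r \<in> weak_radii M" "r $ i < e / 2"
    using cInf_lessD[of "(\<lambda>r. r $ i) ` weak_radii M"] rad by blast
  then obtain K where K: "compactin (weak_topology N) K" "M \<subseteq> K + gen_cball N r"
    unfolding weak_radii_def by blast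
  have "\<forall>n. \<exists>k x. x \<in> C n \<and> k \<in> K \<and> x - k \<in> gen_cball N r"
  proof
    fix n
    obtain x where "x \<in> C n" "x \<in> K + gen_cball N r" using C(2) K(2) by blast
    then show "\<exists>k x. x \<in> C n \<and> k \<in> K \<and> x - k \<in> gen_cball N r"
      by (metis add_diff_cancel_left' set_plus_elim)
  qed
  from choice[OF this] obtain k where k: "\<And>n. \<exists>x. x \<in> C n \<and> k n \<in> K \<and> x - k n \<in> gen_cball N r" by blast
  \<comment> \<open>The centre is a surrogate weak cluster point of the compact parts
    \<open>k n\<close> of points of \<open>C n\<close>.\<close>
  obtain \<kappa> where \<kappa>: "\<And>n. \<kappa> \<in> cl (convex hull (k ` {n..}))"
    using wfip_tails[OF compactin_imp_wfip[OF K(1)], of k] k by blast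
  have "\<exists>c\<in>C n. q (c - \<kappa>) \<le> e" for n
  proof -
    \<comment> \<open>A slab restricting component \<open>i\<close> alone. The convex set
      \<open>C n + ?B\<close> contains all \<open>k m\<close> with \<open>n \<le> m\<close>, hence
      their hull, and \<open>\<kappa>\<close> is within \<open>e / 2\<close> of that hull.\<close>
    let ?B = "{z. N (z - 0) $ i \<le> r $ i}"
    have "convex ?B" by (rule convex_seminorm_le) (auto simp: component)
    moreover have "convex (C n)" using C(1) by (simp add: nested_def)
    ultimately have "convex (C n + ?B)" by (rule convex_set_plus[rotated])
    moreover have "k m \<in> C n + ?B" if "n \<le> m" for m
    proof -
      obtain x where x: "x \<in> C m" "x - k m \<in> gen_cball N r" using k by blast
      have "x \<in> C n" using x(1) nested_antimono[OF C(1) that] by blast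
      moreover have "k m - x \<in> ?B"
        using x(2) gen_norm_uminus[OF gen_norm, of "x - k m"] by (simp add: gen_cball_def less_eq_vec_def)
      ultimately have "x + (k m - x) \<in> C n + ?B" by (rule set_plus_intro)
      then show ?thesis by simp
    qed
    ultimately have sub: "convex hull (k ` {n..}) \<subseteq> C n + ?B" by (intro hull_minimal) auto
    obtain a where a: "a \<in> convex hull (k ` {n..})" "max_norm N (a - \<kappa>) < e / 2"
      using \<kappa>[of n] half_gt_zero[OF e] unfolding cl_def by blast
    obtain c z where c: "c \<in> C n" and z: "z \<in> ?B" "a = c + z"
      using subsetD[OF sub a(1)] by (rule set_plus_elim)
    have "N (c - \<kappa>) $ i \<le> N (c - a) $ i + N (a - \<kappa>) $ i"
      using component(2)[of "c - a" "a - \<kappa>" i] by simp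
    also have "N (c - a) $ i = N z $ i" using z(2) gen_norm_uminus[OF gen_norm, of z] by simp
    also have "N z $ i \<le> e / 2" using z(1) r(2) by simp
    also have "N (a - \<kappa>) $ i \<le> e / 2" using max_norm_component[of N "a - \<kappa>" i] a(2) by simp
    finally show ?thesis using c q by (intro bexI[of _ c]) auto
  qed
  then show "\<exists>k. \<forall>n. \<exists>c\<in>C n. q (c - k) \<le> e" by blast
qed (use M in \<open>auto simp: component max_norm_component\<close>)

section \<open>Reduction to a separable set and the condensing argument\<close>

text \<open>Invariance passes from \<open>Z\<close> to its norm closure without norm continuity of
  \<open>T\<close>: norm limits are weak limits, \<open>T\<close> preserves these, and the closed
  convex set \<open>cl Z\<close> contains them.\<close>

lemma convex_sep_invariant_subset:
  assumes S: "convex S" "clos S" "x0 \<in> S" and T: "T ` S \<subseteq> S"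
    and cont: "\<And>u x. (\<And>n::nat. u n \<in> S) \<Longrightarrow> x \<in> S \<Longrightarrow> wlim u x \<Longrightarrow> wlim (\<lambda>n. T (u n)) (T x)"
  obtains S0 where "x0 \<in> S0" "S0 \<subseteq> S" "convex S0" "clos S0" "sep S0" "T ` S0 \<subseteq> S0"
proof -
  obtain Z where Z: "countable Z" "{x0} \<subseteq> Z" "T ` Z \<subseteq> Z" "convex (cl Z)"
      "\<And>C. {x0} \<subseteq> C \<Longrightarrow> convex C \<Longrightarrow> T ` C \<subseteq> C \<Longrightarrow> Z \<subseteq> C"
    using countable_convex_closure[of "{x0}" T] by (metis countable_empty countable_insert)
  have "Z \<subseteq> S" by (rule Z(5)) (use S T in auto)
  then have "cl Z \<subseteq> S" using S(2) by (rule cl_minimal)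
  moreover have "T x \<in> cl Z" if x: "x \<in> cl Z" for x
  proof -
    obtain u where u: "\<And>n::nat. u n \<in> Z" "(\<lambda>n. max_norm N (u n - x)) \<longlonglongrightarrow> 0"
      using cl_seq[OF x] by blast
    have "wlim (\<lambda>n. T (u n)) (T x)"
      by (rule cont[OF _ _ wlim_of_lim[OF u(2)]]) (use u(1) x \<open>Z \<subseteq> S\<close> \<open>cl Z \<subseteq> S\<close> in auto)
    then show ?thesis
      by (rule wlim_clos_convex[OF _ _ Z(4) clos_cl]) (use Z(3) u(1) subset_cl[of Z] in blast)
  qed
  ultimately show ?thesis
    using that[of "cl Z"] Z(1,2,4) subset_cl[of Z] clos_cl sep_def by blast
qed

theorem weakly_condensing_fixed_point:
  assumes S: "S \<noteq> {}" "clos S" "convex S" and T: "T ` S \<subseteq> S"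
    and cont: "\<And>u x. (\<And>n::nat. u n \<in> S) \<Longrightarrow> x \<in> S \<Longrightarrow> wlim u x \<Longrightarrow> wlim (\<lambda>n. T (u n)) (T x)"
    and cond: "weakly_condensing_on N S T" and bnd: "gen_bounded N (T ` S)"
  shows "\<exists>x\<in>S. T x = x"
proof -
  obtain x0 where x0: "x0 \<in> S" using S(1) by blast
  obtain S0 where S0: "x0 \<in> S0" "S0 \<subseteq> S" "convex S0" "clos S0" "sep S0" "T ` S0 \<subseteq> S0"
    using convex_sep_invariant_subset[OF S(3,2) x0 T cont] by blast
  define \<C> where "\<C> = {C. x0 \<in> C \<and> convex C \<and> clos C \<and> T ` C \<subseteq> C \<and> C \<subseteq> S0}"
  define M where "M = \<Inter>\<C>"
  have "S0 \<in> \<C>" using S0 by (simp add: \<C>_def)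
  then have MS0: "M \<subseteq> S0" by (auto simp: M_def)
  have M: "x0 \<in> M" "convex M" "clos M" "T ` M \<subseteq> M"
    unfolding M_def by (auto simp: \<C>_def intro!: convex_Inter clos_Inter)
  define M' where "M' = cl (convex hull (insert x0 (T ` M)))"
  have "M' \<subseteq> M"
    unfolding M'_def using M by (intro cl_minimal hull_minimal) auto
  moreover have "insert x0 (T ` M) \<subseteq> M'"
    unfolding M'_def using subset_cl hull_subset by (metis order_trans)
  ultimately have "M' \<in> \<C>"
    using MS0 unfolding \<C>_def by (auto simp: M'_def convex_cl clos_cl)
  then have MM': "M = M'" using \<open>M' \<subseteq> M\<close> by (auto simp: M_def)
  have sepM: "sep M" using S0(5) MS0 by (rule sep_subset)
  have TM: "sep (T ` M)" using sepM M(4) by (rule sep_subset)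
  \<comment> \<open>\<open>S\<close> may be unbounded; \<open>M\<close> inherits a bound from
    \<open>T\<close> S\<open>because it is the closed hull of\<close>x0\<open>and\<close>T
    \<open>M\<close>.\<close>
  have "T ` M \<subseteq> T ` S" using MS0 S0(2) by blast
  then have bTM: "gen_bounded N (T ` M)"
    using bnd unfolding gen_bounded_iff[OF gen_norm] by blast
  then obtain B0 where B0: "\<And>x. x \<in> T ` M \<Longrightarrow> max_norm N x \<le> B0"
    using bounded_imp_max_norm_le by blast
  define B where "B = max B0 (max_norm N x0)"
  have "max_norm N x \<le> B" if "x \<in> insert x0 (T ` M)" for x
    using that B0[of x] unfolding B_def by (cases "x = x0") auto
  then have B: "max_norm N x \<le> B" if "x \<in> M" for x
    using that max_norm_le_cl_convex_hull MM' unfolding M'_def by blast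
  then have bM: "gen_bounded N M"
    unfolding gen_bounded_iff[OF gen_norm]
    by (intro exI[of _ "\<chi> i. B"]) (auto simp: less_eq_vec_def gen_dist_le_iff)
  have "weak_radii (T ` M) \<subseteq> weak_radii M"
    using weak_radii_closed_convex_hull[OF TM bTM, of x0] unfolding M'_def[symmetric] MM'[symmetric] .
  then have le: "weak_noncompactness N M \<le> weak_noncompactness N (T ` M)"
    by (rule weak_noncompactness_mono[OF _ bounded_imp_weak_radii[OF bTM]])
  have "weak_noncompactness N M = 0"
  proof (rule ccontr)
    assume "weak_noncompactness N M \<noteq> 0"
    \<comment> \<open>In the order of \<open>real^'n\<close> a nonnegative nonzero vector is already
      above 0, so one nonzero component triggers the condensing condition.\<close>
    then have "0 < weak_noncompactness N M"
      using weak_noncompactness_nonneg[OF bounded_imp_weak_radii[OF bM]] by (simp add: less_le)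
    then have "weak_noncompactness N (T ` M) < weak_noncompactness N M"
      using cond bM MS0 S0(2) unfolding weakly_condensing_on_def by blast
    then show False using le by simp
  qed
  then have "wfip M"
    by (rule weak_noncompactness_zero_imp_wfip[OF M(2,3) bounded_imp_weak_radii[OF bM]])
  then have "wseq M" by (rule wfip_imp_wseq[OF sepM _ B])
  have "\<exists>x\<in>M. T x = x"
    by (rule weakly_seq_continuous_fixed_point[OF M(2) sepM \<open>wseq M\<close>])
      (use M MS0 S0(2) in \<open>auto intro!: cont\<close>)
  then show ?thesis using MS0 S0(2) by blast
qed

end

theorem theorem2p3:
  fixes N :: "'a::real_vector \<Rightarrow> real^'n"
    and S :: "'a set" and T :: "'a \<Rightarrow> 'a"
  assumes "gen_banach N"
    and "S \<noteq> {}" and "closedin (gen_topology N) S" and "convex S"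
    and "T ` S \<subseteq> S"
    and "weakly_seq_continuous_on N S T"
    and "weakly_condensing_on N S T"
    and "gen_bounded N (T ` S)"
  shows "\<exists>x\<in>S. T x = x"
proof -
  interpret gen_banach_space N by unfold_locales (rule assms(1))
  have cont: "wlim (\<lambda>n. T (u n)) (T x)" if "\<And>n::nat. u n \<in> S" "x \<in> S" "wlim u x" for u x
    using assms(6) that unfolding weakly_seq_continuous_on_def limitin_weak_topology_iff by blast
  show ?thesis
    by (rule weakly_condensing_fixed_point[OF assms(2) assms(3)[unfolded closedin_gen_topology_iff]
          assms(4,5) _ assms(7,8)]) (rule cont)
qed

end
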